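(* Let $V$ be a finite-dimensional irreducible $\boxtimes$-module. Then there exists a unique $\mathcal{O}$-module structure on $V$ such that the standard generators $X,Y$ of $\mathcal{O}$ act on $V$ as $X_{01},X_{23}$ respectively. This $\mathcal{O}$-module structure is irreducible and has type $(0,0)$.
   Context: $\mathbb{K}$ is an algebraically closed field of characteristic $0$. All Lie algebras and modules are over $\mathbb{K}$; irreducible modules are nonzero. Tetrahedron algebra: let $\mathbb{I}=\{0,1,2,3\}$. $\boxtimes$ is the Lie algebra over $\mathbb{K}$ with generators $\{X_{rs} \mid r,s\in\mathbb{I}, r\neq s\}$ and relations: (i) for distinct $r,s\in\mathbb{I}$, $X_{rs}+X_{sr}=0$; (ii) for mutually distinct $r,s,t\in\mathbb{I}$, $[X_{rs},X_{st}]=2X_{rs}+2X_{st}$; (iii) for mutually distinct $r,s,t,u\in\mathbb{I}$, $[X_{rs},[X_{rs},[X_{rs},X_{tu}]]]=4[X_{rs},X_{tu}]$. Onsager algebra: $\mathcal{O}$ is the Lie algebra over $\mathbb{K}$ with generators $X,Y$ (the standard generators) and relations $[X,[X,[X,Y]]]=4[X,Y]$ and $[Y,[Y,[Y,X]]]=4[Y,X]$. Type: for every finite-dimensional irreducible $\mathcal{O}$-module $V$, $X$ and $Y$ are diagonalizable on $V$ and there exist an integer $d\geq 0$ and scalars $\alpha,\alpha^*\in\mathbb{K}$ such that the set of distinct eigenvalues of $X$ (resp. $Y$) on $V$ is $\{d-2i+\alpha \mid 0\leq i\leq d\}$ (resp. $\{d-2i+\alpha^* \mid 0\leq i\leq d\}$).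 The ordered pair $(\alpha,\alpha^* )$ is called the type of $V$, and $d$ its diameter. *)

theory Defs
  imports "HOL-Computational_Algebra.Computational_Algebra"
begin

section \<open>Lie algebras and their modules\<close>

locale lie_algebra = vector_space scale
  for scale :: "'k::field \<Rightarrow> 'l::ab_group_add \<Rightarrow> 'l" +
  fixes bracket :: "'l \<Rightarrow> 'l \<Rightarrow> 'l"
  assumes bracket_add_left: "bracket (x + y) z = bracket x z + bracket y z"
    and bracket_add_right: "bracket x (y + z) = bracket x y + bracket x z"
    and bracket_scale_left: "bracket (scale a x) y = scale a (bracket x y)"
    and bracket_scale_right: "bracket x (scale a y) = scale a (bracket x y)"
    and bracket_self: "bracket x x = 0"
    and jacobi: "bracket x (bracket y z) + (bracket y (bracket z x) + bracket z (bracket x y)) = 0"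

locale lie_module = L: lie_algebra scaleL bracket + V: vector_space scaleV
  for scaleL :: "'k::field \<Rightarrow> 'l::ab_group_add \<Rightarrow> 'l"
    and bracket :: "'l \<Rightarrow> 'l \<Rightarrow> 'l"
    and scaleV :: "'k \<Rightarrow> 'v::ab_group_add \<Rightarrow> 'v" +
  fixes act :: "'l \<Rightarrow> 'v \<Rightarrow> 'v"
  assumes act_add_left: "act (x + y) v = act x v + act y v"
    and act_add_right: "act x (v + w) = act x v + act x w"
    and act_scale_left: "act (scaleL a x) v = scaleV a (act x v)"
    and act_scale_right: "act x (scaleV a v) = scaleV a (act x v)"
    and act_bracket: "act (bracket x y) v = act x (act y v) - act y (act x v)"
begin

definition submodule :: "'v set \<Rightarrow> bool" where
  "submodule W \<longleftrightarrow> V.subspace W \<and> (\<forall>x. \<forall>w\<in>W. act x w \<in> W)"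

end

locale irreducible_lie_module = lie_module scaleL bracket scaleV act
  for scaleL :: "'k::field \<Rightarrow> 'l::ab_group_add \<Rightarrow> 'l"
    and bracket :: "'l \<Rightarrow> 'l \<Rightarrow> 'l"
    and scaleV :: "'k \<Rightarrow> 'v::ab_group_add \<Rightarrow> 'v"
    and act :: "'l \<Rightarrow> 'v \<Rightarrow> 'v" +
  assumes nonzero: "\<exists>v::'v. v \<noteq> 0"
    and irreducible: "submodule W \<Longrightarrow> W = {0} \<or> W = UNIV"

context vector_space
begin

definition finite_dimensional :: bool where
  "finite_dimensional \<longleftrightarrow> (\<exists>B. finite_dimensional_vector_space scale B)"

definition eigenvalues :: "('b \<Rightarrow> 'b) \<Rightarrow> 'a set" where
  "eigenvalues f = {c. \<exists>v. v \<noteq> 0 \<and> f v = scale c v}"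

definition diagonalizable :: "('b \<Rightarrow> 'b) \<Rightarrow> bool" where
  "diagonalizable f \<longleftrightarrow>
     (\<exists>B. independent B \<and> span B = UNIV \<and> (\<forall>b\<in>B. \<exists>c. f b = scale c b))"

end

section \<open>Lie algebras given by generators and relations\<close>

datatype ('k, 'x) lie_expr =
    LGen 'x
  | LZero
  | LAdd "('k, 'x) lie_expr" "('k, 'x) lie_expr"
  | LScale 'k "('k, 'x) lie_expr"
  | LBracket "('k, 'x) lie_expr" "('k, 'x) lie_expr"

text \<open>
  The least congruence on Lie expressions that contains \<open>R\<close> and validates the axioms of a Lie
  algebra over \<open>'k\<close>. The quotient of the expressions by it is the Lie algebra presented by the
  generators \<open>'x\<close> and the relations \<open>s = t\<close> for \<open>(s, t) \<in> R\<close>.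
\<close>

inductive lie_cong ::
  "(('k::field, 'x) lie_expr \<times> ('k, 'x) lie_expr) set \<Rightarrow>
     ('k, 'x) lie_expr \<Rightarrow> ('k, 'x) lie_expr \<Rightarrow> bool"
  for R where
  rel: "(s, t) \<in> R \<Longrightarrow> lie_cong R s t"
| refl: "lie_cong R s s"
| sym: "lie_cong R s t \<Longrightarrow> lie_cong R t s"
| trans: "lie_cong R s t \<Longrightarrow> lie_cong R t u \<Longrightarrow> lie_cong R s u"
| add: "lie_cong R s s' \<Longrightarrow> lie_cong R t t' \<Longrightarrow> lie_cong R (LAdd s t) (LAdd s' t')"
| scale: "lie_cong R s s' \<Longrightarrow> lie_cong R (LScale a s) (LScale a s')"
| bracket: "lie_cong R s s' \<Longrightarrow> lie_cong R t t' \<Longrightarrow> lie_cong R (LBracket s t) (LBracket s' t')"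
| add_assoc: "lie_cong R (LAdd (LAdd s t) u) (LAdd s (LAdd t u))"
| add_commute: "lie_cong R (LAdd s t) (LAdd t s)"
| add_zero: "lie_cong R (LAdd LZero s) s"
| add_inverse: "lie_cong R (LAdd (LScale (-1) s) s) LZero"
| scale_add_right: "lie_cong R (LScale a (LAdd s t)) (LAdd (LScale a s) (LScale a t))"
| scale_add_left: "lie_cong R (LScale (a + b) s) (LAdd (LScale a s) (LScale b s))"
| scale_scale: "lie_cong R (LScale a (LScale b s)) (LScale (a * b) s)"
| scale_one: "lie_cong R (LScale 1 s) s"
| bracket_add_left: "lie_cong R (LBracket (LAdd s t) u) (LAdd (LBracket s u) (LBracket t u))"
| bracket_add_right: "lie_cong R (LBracket s (LAdd t u)) (LAdd (LBracket s t) (LBracket s u))"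
| bracket_scale_left: "lie_cong R (LBracket (LScale a s) t) (LScale a (LBracket s t))"
| bracket_scale_right: "lie_cong R (LBracket s (LScale a t)) (LScale a (LBracket s t))"
| bracket_self: "lie_cong R (LBracket s s) LZero"
| jacobi: "lie_cong R (LAdd (LBracket s (LBracket t u))
             (LAdd (LBracket t (LBracket u s)) (LBracket u (LBracket s t)))) LZero"

lemma equivp_lie_cong: "equivp (lie_cong R)"
  by (rule equivpI)
     (auto intro!: reflpI sympI transpI intro: lie_cong.refl lie_cong.sym lie_cong.trans)

section \<open>The tetrahedron algebra\<close>

definition tetra_index :: "nat set" where
  "tetra_index = {0, 1, 2, 3}"

typedef tetra_gen = "{(r, s). r \<in> tetra_index \<and> s \<in> tetra_index \<and> r \<noteq> s}"
  by (rule exI[of _ "(0, 1)"]) (simp add: tetra_index_def)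

text \<open>Meaningful only for distinct \<open>r, s \<in> tetra_index\<close>; unspecified otherwise.\<close>

definition tetra_gen_expr :: "nat \<Rightarrow> nat \<Rightarrow> ('k, tetra_gen) lie_expr" where
  "tetra_gen_expr r s = LGen (Abs_tetra_gen (r, s))"

definition tetra_relations ::
  "(('k::field, tetra_gen) lie_expr \<times> ('k, tetra_gen) lie_expr) set" where
  "tetra_relations =
     {(LAdd (tetra_gen_expr r s) (tetra_gen_expr s r), LZero) | r s.
        {r, s} \<subseteq> tetra_index \<and> distinct [r, s]} \<union>
     {(LBracket (tetra_gen_expr r s) (tetra_gen_expr s t),
       LAdd (LScale 2 (tetra_gen_expr r s)) (LScale 2 (tetra_gen_expr s t))) | r s t.
        {r, s, t} \<subseteq> tetra_index \<and> distinct [r, s, t]} \<union>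
     {(LBracket (tetra_gen_expr r s) (LBracket (tetra_gen_expr r s)
         (LBracket (tetra_gen_expr r s) (tetra_gen_expr t u))),
       LScale 4 (LBracket (tetra_gen_expr r s) (tetra_gen_expr t u))) | r s t u.
        {r, s, t, u} \<subseteq> tetra_index \<and> distinct [r, s, t, u]}"

quotient_type (overloaded) 'k tetra =
  "('k::field, tetra_gen) lie_expr" / "lie_cong tetra_relations"
  by (rule equivp_lie_cong)

instantiation tetra :: (field) ab_group_add
begin

lift_definition zero_tetra :: "'a tetra" is LZero .
lift_definition plus_tetra :: "'a tetra \<Rightarrow> 'a tetra \<Rightarrow> 'a tetra" is LAdd by (rule lie_cong.add)
lift_definition uminus_tetra :: "'a tetra \<Rightarrow> 'a tetra" is "LScale (-1)" by (rule lie_cong.scale)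
definition minus_tetra :: "'a tetra \<Rightarrow> 'a tetra \<Rightarrow> 'a tetra" where "minus_tetra a b = a + - b"

instance
proof
  fix a b c :: "'a tetra"
  show "a + b + c = a + (b + c)" by transfer (rule lie_cong.add_assoc)
  show "a + b = b + a" by transfer (rule lie_cong.add_commute)
  show "0 + a = a" by transfer (rule lie_cong.add_zero)
  show "- a + a = 0" by transfer (rule lie_cong.add_inverse)
  show "a - b = a + - b" by (simp add: minus_tetra_def)
qed

end

lift_definition tetra_scale :: "'k::field \<Rightarrow> 'k tetra \<Rightarrow> 'k tetra" is LScale
  by (rule lie_cong.scale)

lift_definition tetra_bracket :: "'k::field tetra \<Rightarrow> 'k tetra \<Rightarrow> 'k tetra" is LBracket
  by (rule lie_cong.bracket)

lemma lie_algebra_tetra: "lie_algebra tetra_scale tetra_bracket"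
proof
  fix a b :: 'a and x y z :: "'a tetra"
  show "tetra_scale a (x + y) = tetra_scale a x + tetra_scale a y"
    by transfer (rule lie_cong.scale_add_right)
  show "tetra_scale (a + b) x = tetra_scale a x + tetra_scale b x"
    by transfer (rule lie_cong.scale_add_left)
  show "tetra_scale a (tetra_scale b x) = tetra_scale (a * b) x"
    by transfer (rule lie_cong.scale_scale)
  show "tetra_scale 1 x = x"
    by transfer (rule lie_cong.scale_one)
  show "tetra_bracket (x + y) z = tetra_bracket x z + tetra_bracket y z"
    by transfer (rule lie_cong.bracket_add_left)
  show "tetra_bracket x (y + z) = tetra_bracket x y + tetra_bracket x z"
    by transfer (rule lie_cong.bracket_add_right)
  show "tetra_bracket (tetra_scale a x) y = tetra_scale a (tetra_bracket x y)"
    by transfer (rule lie_cong.bracket_scale_left)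
  show "tetra_bracket x (tetra_scale a y) = tetra_scale a (tetra_bracket x y)"
    by transfer (rule lie_cong.bracket_scale_right)
  show "tetra_bracket x x = 0"
    by transfer (rule lie_cong.bracket_self)
  show "tetra_bracket x (tetra_bracket y z) + (tetra_bracket y (tetra_bracket z x) + tetra_bracket z (tetra_bracket x y)) = 0"
    by transfer (rule lie_cong.jacobi)
qed

lift_definition tetra_X :: "nat \<Rightarrow> nat \<Rightarrow> 'k::field tetra" is tetra_gen_expr .

lemma tetra_X_skew:
  assumes "{r, s} \<subseteq> tetra_index" "distinct [r, s]"
  shows "(tetra_X r s :: 'k::field tetra) + tetra_X s r = 0"
  using assms by transfer (rule lie_cong.rel, unfold tetra_relations_def, blast)

lemma tetra_X_bracket:
  assumes "{r, s, t} \<subseteq> tetra_index" "distinct [r, s, t]"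
  shows "tetra_bracket (tetra_X r s :: 'k::field tetra) (tetra_X s t) =
           tetra_scale 2 (tetra_X r s) + tetra_scale 2 (tetra_X s t)"
  using assms by transfer (rule lie_cong.rel, unfold tetra_relations_def, blast)

lemma tetra_X_Dolan_Grady:
  assumes "{r, s, t, u} \<subseteq> tetra_index" "distinct [r, s, t, u]"
  shows "tetra_bracket (tetra_X r s :: 'k::field tetra)
           (tetra_bracket (tetra_X r s) (tetra_bracket (tetra_X r s) (tetra_X t u))) =
         tetra_scale 4 (tetra_bracket (tetra_X r s) (tetra_X t u))"
  using assms by transfer (rule lie_cong.rel, unfold tetra_relations_def, blast)

section \<open>The Onsager algebra\<close>

datatype onsager_gen = Onsager_X | Onsager_Y

definition onsager_relations ::
  "(('k::field, onsager_gen) lie_expr \<times> ('k, onsager_gen) lie_expr) set" where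
  "onsager_relations =
     (let X = LGen Onsager_X; Y = LGen Onsager_Y in
       {(LBracket X (LBracket X (LBracket X Y)), LScale 4 (LBracket X Y)),
        (LBracket Y (LBracket Y (LBracket Y X)), LScale 4 (LBracket Y X))})"

quotient_type (overloaded) 'k onsager =
  "('k::field, onsager_gen) lie_expr" / "lie_cong onsager_relations"
  by (rule equivp_lie_cong)

instantiation onsager :: (field) ab_group_add
begin

lift_definition zero_onsager :: "'a onsager" is LZero .
lift_definition plus_onsager :: "'a onsager \<Rightarrow> 'a onsager \<Rightarrow> 'a onsager" is LAdd by (rule lie_cong.add)
lift_definition uminus_onsager :: "'a onsager \<Rightarrow> 'a onsager" is "LScale (-1)" by (rule lie_cong.scale)
definition minus_onsager :: "'a onsager \<Rightarrow> 'a onsager \<Rightarrow> 'a onsager" where "minus_onsager a b = a + - b"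

instance
proof
  fix a b c :: "'a onsager"
  show "a + b + c = a + (b + c)" by transfer (rule lie_cong.add_assoc)
  show "a + b = b + a" by transfer (rule lie_cong.add_commute)
  show "0 + a = a" by transfer (rule lie_cong.add_zero)
  show "- a + a = 0" by transfer (rule lie_cong.add_inverse)
  show "a - b = a + - b" by (simp add: minus_onsager_def)
qed

end

lift_definition onsager_scale :: "'k::field \<Rightarrow> 'k onsager \<Rightarrow> 'k onsager" is LScale
  by (rule lie_cong.scale)

lift_definition onsager_bracket :: "'k::field onsager \<Rightarrow> 'k onsager \<Rightarrow> 'k onsager" is LBracket
  by (rule lie_cong.bracket)

lemma lie_algebra_onsager: "lie_algebra onsager_scale onsager_bracket"
proof
  fix a b :: 'a and x y z :: "'a onsager"
  show "onsager_scale a (x + y) = onsager_scale a x + onsager_scale a y"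
    by transfer (rule lie_cong.scale_add_right)
  show "onsager_scale (a + b) x = onsager_scale a x + onsager_scale b x"
    by transfer (rule lie_cong.scale_add_left)
  show "onsager_scale a (onsager_scale b x) = onsager_scale (a * b) x"
    by transfer (rule lie_cong.scale_scale)
  show "onsager_scale 1 x = x"
    by transfer (rule lie_cong.scale_one)
  show "onsager_bracket (x + y) z = onsager_bracket x z + onsager_bracket y z"
    by transfer (rule lie_cong.bracket_add_left)
  show "onsager_bracket x (y + z) = onsager_bracket x y + onsager_bracket x z"
    by transfer (rule lie_cong.bracket_add_right)
  show "onsager_bracket (onsager_scale a x) y = onsager_scale a (onsager_bracket x y)"
    by transfer (rule lie_cong.bracket_scale_left)
  show "onsager_bracket x (onsager_scale a y) = onsager_scale a (onsager_bracket x y)"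
    by transfer (rule lie_cong.bracket_scale_right)
  show "onsager_bracket x x = 0"
    by transfer (rule lie_cong.bracket_self)
  show "onsager_bracket x (onsager_bracket y z) + (onsager_bracket y (onsager_bracket z x) + onsager_bracket z (onsager_bracket x y)) = 0"
    by transfer (rule lie_cong.jacobi)
qed

lift_definition onsager_X :: "'k::field onsager" is "LGen Onsager_X" .
lift_definition onsager_Y :: "'k::field onsager" is "LGen Onsager_Y" .

lemma onsager_Dolan_Grady:
  fixes X Y :: "'k::field onsager"
  defines "X \<equiv> onsager_X" and "Y \<equiv> onsager_Y"
  shows "onsager_bracket X (onsager_bracket X (onsager_bracket X Y)) =
           onsager_scale 4 (onsager_bracket X Y)"
    and "onsager_bracket Y (onsager_bracket Y (onsager_bracket Y X)) =
           onsager_scale 4 (onsager_bracket Y X)"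
  unfolding X_def Y_def
  by (transfer, rule lie_cong.rel, simp add: onsager_relations_def Let_def)+

text \<open>
  For a finite-dimensional irreducible module, \<open>(\<alpha>, \<alpha>')\<close> is its type. The diameter \<open>d\<close> is common
  to both generators.
\<close>

definition onsager_has_type ::
  "('k::field \<Rightarrow> 'v::ab_group_add \<Rightarrow> 'v) \<Rightarrow> ('k onsager \<Rightarrow> 'v \<Rightarrow> 'v) \<Rightarrow> 'k \<times> 'k \<Rightarrow> bool" where
  "onsager_has_type scale act = (\<lambda>(\<alpha>, \<alpha>').
     vector_space.diagonalizable scale (act onsager_X) \<and>
     vector_space.diagonalizable scale (act onsager_Y) \<and>
     (\<exists>d::nat.
        vector_space.eigenvalues scale (act onsager_X) =
          {of_nat d - 2 * of_nat i + \<alpha> | i. i \<le> d} \<and>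
        vector_space.eigenvalues scale (act onsager_Y) =
          {of_nat d - 2 * of_nat i + \<alpha>' | i. i \<le> d}))"

end

theory Submission
  imports Defs
begin

text \<open>
  On the \<open>c\<close>-eigenspace of \<open>X\<^sub>r\<^sub>s\<close>, the operators \<open>X\<^sub>r\<^sub>t - c\<close> and \<open>X\<^sub>s\<^sub>t + c\<close> shift the
  eigenvalue by \<open>-2\<close> and \<open>2\<close>, and by the Dolan-Grady relation \<open>X\<^sub>t\<^sub>u\<close> shifts it by \<open>0\<close> or
  \<open>\<plusminus>2\<close>. So, by irreducibility, \<open>X\<^sub>r\<^sub>s\<close> is diagonalizable and its eigenvalues form an arithmetic
  progression of step \<open>2\<close>. As \<open>X\<^sub>r\<^sub>t\<close> is triangular with respect to the flag of eigenspaces of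
  \<open>X\<^sub>r\<^sub>s\<close>, the spectrum and the flag of \<open>X\<^sub>r\<^sub>s\<close> depend on \<open>r\<close> only; together with
  \<open>X\<^sub>s\<^sub>r = -X\<^sub>r\<^sub>s\<close> all spectra equal \<open>{d, d - 2, \<dots>, -d}\<close>, and there are four mutually
  opposite flags.

  Let \<open>W \<noteq> 0\<close> be minimal among the subspaces invariant under \<open>X\<^sub>0\<^sub>1\<close> and \<open>X\<^sub>2\<^sub>3\<close>. Oppositeness
  of the flags forces \<open>X\<^sub>0\<^sub>1, X\<^sub>1\<^sub>0, X\<^sub>2\<^sub>3, X\<^sub>3\<^sub>2\<close> to have the same lowest eigenvalue on \<open>W\<close>, whence
  \<open>W\<close> contains an eigenvector of each \<open>X\<^sub>r\<^sub>s\<close> with \<open>r \<in> {0, 1}\<close>, \<open>s \<in> {2, 3}\<close>. The span of the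
  \<open>X\<^sub>r\<^sub>s\<close>-eigenvectors in \<open>W\<close> is invariant under \<open>X\<^sub>0\<^sub>1\<close> and \<open>X\<^sub>2\<^sub>3\<close>, so it is \<open>W\<close>. Hence \<open>W\<close> is
  invariant under all generators.
\<close>

section \<open>Eigenvectors of operators on finite-dimensional spaces\<close>

context finite_dimensional_vector_space
begin

definition eigenspace :: "('b \<Rightarrow> 'b) \<Rightarrow> 'a \<Rightarrow> 'b set" where
  "eigenspace f c = {v. f v = scale c v}"

lemma mem_eigenspace_iff: "v \<in> eigenspace f c \<longleftrightarrow> f v = scale c v"
  by (simp add: eigenspace_def)

lemma eigenvalues_iff: "c \<in> eigenvalues f \<longleftrightarrow> (\<exists>v. v \<noteq> 0 \<and> v \<in> eigenspace f c)"
  by (simp add: eigenvalues_def eigenspace_def)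

lemma subspace_eigenspace:
  assumes "Vector_Spaces.linear scale scale f"
  shows "subspace (eigenspace f c)"
proof -
  interpret f: Vector_Spaces.linear scale scale f by fact
  show ?thesis
    by (auto simp: subspace_def eigenspace_def f.add f.scale scale_right_distrib scale_left_commute)
qed

lemma linear_maps_span_into:
  assumes "Vector_Spaces.linear scale scale f" "subspace W" "f ` A \<subseteq> W" "v \<in> span A"
  shows "f v \<in> W"
proof -
  interpret f: Vector_Spaces.linear scale scale f by fact
  show ?thesis
    using span_minimal[of A "{v. f v \<in> W}"] f.subspace_linear_preimage[OF assms(2)] assms(3,4)
    by blast
qed

lemma linear_minus_scale:
  assumes "Vector_Spaces.linear scale scale f"
  shows "Vector_Spaces.linear scale scale (\<lambda>v. f v - scale c v)"
proof -
  interpret f: Vector_Spaces.linear scale scale f by fact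
  show ?thesis
    by (intro Vector_Spaces.linear.intro vector_space_axioms module_hom.intro module_axioms
          module_hom_axioms.intro)
      (simp_all add: f.add f.scale scale_right_distrib scale_right_diff_distrib mult.commute)
qed

lemma diagonalizableI:
  assumes "span (\<Union>c. eigenspace f c) = UNIV"
  shows "diagonalizable f"
proof -
  obtain B where B: "B \<subseteq> (\<Union>c. eigenspace f c)" "independent B" "(\<Union>c. eigenspace f c) \<subseteq> span B"
    using maximal_independent_subset by blast
  then have "span B = UNIV"
    using assms span_minimal[OF B(3)] by auto
  then show ?thesis
    unfolding diagonalizable_def using B(1,2) by (auto simp: eigenspace_def subset_iff)
qed

section \<open>Triangular operators\<close>

text \<open>If \<open>\<mu> \<noteq> c (Suc n)\<close>, then
  \<open>f v - scale (c (Suc n)) v\<close> is a nonzero multiple of \<open>v\<close>, so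
  \<open>v\<close> already lies in \<open>G n\<close>, and one descends.\<close>

lemma triangular_eigenvalue:
  assumes f: "Vector_Spaces.linear scale scale f"
    and sub: "\<And>n. subspace (G n)"
    and zero: "\<And>v. v \<in> G 0 \<Longrightarrow> f v = scale (c 0) v"
    and step: "\<And>n v. v \<in> G (Suc n) \<Longrightarrow> f v - scale (c (Suc n)) v \<in> G n"
    and v: "v \<in> G n" "v \<noteq> 0" "f v = scale \<mu> v"
  shows "\<exists>i\<le>n. \<mu> = c i"
  using v
proof (induction n)
  case 0
  then have "scale \<mu> v = scale (c 0) v" using zero by simp
  then show ?case using 0 by simp
next
  case (Suc n)
  show ?case
  proof (cases "\<mu> = c (Suc n)")
    case False
    have "scale (\<mu> - c (Suc n)) v \<in> G n"
      using step[OF Suc.prems(1)] Suc.prems(3) by (simp add: scale_left_diff_distrib)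
    then have "scale (inverse (\<mu> - c (Suc n))) (scale (\<mu> - c (Suc n)) v) \<in> G n"
      by (rule subspace_scale[OF sub])
    then have "v \<in> G n" using False by simp
    with Suc.IH Suc.prems show ?thesis by (meson le_SucI)
  qed auto
qed

text \<open>As \<open>c\<close> is injective, \<open>f - c (Suc n)\<close> is onto on the span of
  the eigenvectors already found. So a vector of \<open>G (Suc n)\<close> becomes an eigenvector for
  \<open>c (Suc n)\<close> after subtracting a suitable \<open>u\<close> of that span.\<close>

lemma triangular_eigenspace_span:
  assumes f: "Vector_Spaces.linear scale scale f"
    and sub: "\<And>n. subspace (G n)"
    and mono: "\<And>n. G n \<subseteq> G (Suc n)"
    and zero: "\<And>v. v \<in> G 0 \<Longrightarrow> f v = scale (c 0) v"
    and step: "\<And>n v. v \<in> G (Suc n) \<Longrightarrow> f v - scale (c (Suc n)) v \<in> G n"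
    and inj: "inj c"
  shows "G n \<subseteq> span (\<Union>i\<le>n. G n \<inter> eigenspace f (c i))"
proof (induction n)
  case 0
  then show ?case using zero by (auto intro!: span_base simp: eigenspace_def)
next
  case (Suc n)
  interpret f: Vector_Spaces.linear scale scale f by fact
  let ?f = "\<lambda>v. f v - scale (c (Suc n)) v"
  let ?E = "\<Union>i\<le>n. G n \<inter> eigenspace f (c i)"
  interpret f': Vector_Spaces.linear scale scale ?f by (rule linear_minus_scale[OF f])
  have "?E \<subseteq> ?f ` span ?E"
  proof
    fix e assume "e \<in> ?E"
    then obtain i where i: "i \<le> n" "e \<in> ?E" "f e = scale (c i) e" by (auto simp: eigenspace_def)
    then have ne: "c i - c (Suc n) \<noteq> 0" using injD[OF inj, of i "Suc n"] by auto
    define u where "u = scale (inverse (c i - c (Suc n))) e"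
    have "?f u = scale (inverse (c i - c (Suc n))) (scale (c i - c (Suc n)) e)"
      by (simp only: u_def f.scale i(3) scale_left_diff_distrib scale_right_diff_distrib
          scale_left_commute[of _ "c (Suc n)"])
    then have "?f u = e" using ne by simp
    moreover have "u \<in> span ?E" unfolding u_def using i(2) by (intro span_scale span_base)
    ultimately show "e \<in> ?f ` span ?E" by force
  qed
  then have surj: "span ?E \<subseteq> ?f ` span ?E"
    by (intro span_minimal f'.subspace_image subspace_span)
  have spanE: "span ?E \<subseteq> G n" by (intro span_minimal sub) auto
  have "?E \<subseteq> (\<Union>i\<le>Suc n. G (Suc n) \<inter> eigenspace f (c i))"
    using mono[of n] by (auto simp: le_Suc_eq)
  note into = span_mono[OF this]
  show ?case
  proof
    fix v assume v: "v \<in> G (Suc n)"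
    then have "?f v \<in> span ?E" using step Suc.IH by blast
    then obtain u where u: "u \<in> span ?E" "?f v = ?f u" using surj by blast
    have "?f (v - u) = 0" using u(2) f'.diff by simp
    then have "v - u \<in> eigenspace f (c (Suc n))" by (simp add: eigenspace_def)
    moreover have "v - u \<in> G (Suc n)"
      using v u(1) spanE mono[of n] by (blast intro: subspace_diff[OF sub])
    ultimately have "v - u \<in> (\<Union>i\<le>Suc n. G (Suc n) \<inter> eigenspace f (c i))" by blast
    then have "(v - u) + u \<in> span (\<Union>i\<le>Suc n. G (Suc n) \<inter> eigenspace f (c i))"
      using u(1) into by (blast intro: span_add span_base)
    then show "v \<in> span (\<Union>i\<le>Suc n. G (Suc n) \<inter> eigenspace f (c i))" by simp
  qed
qed

section \<open>Polynomials in an operator; existence and finiteness of eigenvalues\<close>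

text \<open>The vector p(f) v, computed by Horner's scheme.\<close>

definition poly_apply :: "('b \<Rightarrow> 'b) \<Rightarrow> 'a poly \<Rightarrow> 'b \<Rightarrow> 'b" where
  "poly_apply f p v = fold_coeffs (\<lambda>a w. scale a v + f w) p 0"

context
  fixes f
  assumes f: "Vector_Spaces.linear scale scale f"
begin

interpretation f: Vector_Spaces.linear scale scale f by (rule f)

lemma poly_apply_0 [simp]: "poly_apply f 0 v = 0"
  by (simp add: poly_apply_def)

lemma poly_apply_pCons [simp]: "poly_apply f (pCons a p) v = scale a v + f (poly_apply f p v)"
  by (cases "p = 0 \<and> a = 0") (auto simp: poly_apply_def)

lemma poly_apply_add: "poly_apply f (p + q) v = poly_apply f p v + poly_apply f q v"
  by (induction p q rule: poly_induct2) (simp_all add: f.add scale_left_distrib)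

lemma poly_apply_smult: "poly_apply f (smult c p) v = scale c (poly_apply f p v)"
  by (induction p) (simp_all add: f.scale scale_right_distrib)

lemma poly_apply_sum: "poly_apply f (\<Sum>i\<in>I. p i) v = (\<Sum>i\<in>I. poly_apply f (p i) v)"
  by (induction I rule: infinite_finite_induct) (simp_all add: poly_apply_add)

lemma poly_apply_monom: "poly_apply f (monom c n) v = scale c ((f ^^ n) v)"
  by (induction n) (simp_all add: monom_0 monom_Suc f.scale)

lemma poly_apply_linear_factor_mult:
  "poly_apply f ([:- c, 1:] * q) v = f (poly_apply f q v) - scale c (poly_apply f q v)"
proof -
  have "[:- c, 1:] * q = smult (- c) q + pCons 0 q" by simp
  then show ?thesis by (simp only: poly_apply_add poly_apply_smult poly_apply_pCons) simp
qed

end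

text \<open>More than \<open>dimension\<close> vectors \<open>(f ^^ n) v\<close> are linearly
  dependent, and a dependency gives the coefficients. As \<open>dependent\<close> speaks of sets, a
  repetition among the powers is treated apart, by a difference of two monomials.\<close>

lemma exists_annihilating_poly:
  assumes f: "Vector_Spaces.linear scale scale f"
  shows "\<exists>p. p \<noteq> 0 \<and> poly_apply f p v = 0"
proof (cases "inj (\<lambda>n. (f ^^ n) v)")
  case False
  then obtain i j where ij: "i \<noteq> j" "(f ^^ i) v = (f ^^ j) v" by (auto simp: inj_def)
  let ?p = "monom 1 i + monom (- 1) j :: 'a poly"
  have "coeff ?p i = 1" using ij by simp
  then have "?p \<noteq> 0" by (metis coeff_0 zero_neq_one)
  moreover have "poly_apply f ?p v = 0"
    using ij by (simp add: poly_apply_add[OF f] poly_apply_monom[OF f])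
  ultimately show ?thesis by blast
next
  case True
  let ?g = "\<lambda>n. (f ^^ n) v"
  let ?S = "?g ` {..dimension}"
  have "card ?S = Suc dimension"
    using True by (simp add: card_image inj_on_def)
  then have "dependent ?S"
    using independent_card_le_dim[of ?S UNIV] by (auto simp: dimension_def)
  then obtain u where u: "\<exists>w\<in>?S. u w \<noteq> 0" "(\<Sum>w\<in>?S. scale (u w) w) = 0"
    by (subst (asm) dependent_finite) auto
  then obtain n where n: "n \<le> dimension" "u (?g n) \<noteq> 0" by auto
  let ?p = "\<Sum>i\<le>dimension. monom (u (?g i)) i"
  have "coeff ?p n = u (?g n)" using n by (simp add: coeff_sum)
  then have "?p \<noteq> 0" using n by (metis coeff_0)
  moreover have "poly_apply f ?p v = (\<Sum>w\<in>?S. scale (u w) w)"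
    using True
    by (subst sum.reindex) (auto simp: poly_apply_sum[OF f] poly_apply_monom[OF f] inj_on_def)
  ultimately show ?thesis using u by auto
qed

text \<open>The spans of initial segments of \<open>e\<close> form a flag on which \<open>f\<close>
  is triangular with diagonal \<open>c\<close>, so \<open>e n\<close> with its new eigenvalue lies
  outside. The cardinality is carried along because independence of a set does not exclude
  repetitions in \<open>e\<close>.\<close>

lemma independent_eigenvectors:
  assumes f: "Vector_Spaces.linear scale scale f"
    and e: "\<And>i. e i \<noteq> 0" "\<And>i. f (e i) = scale (c i) (e i)"
    and inj: "inj c"
  shows "independent (e ` {..<n}) \<and> card (e ` {..<n :: nat}) = n"
proof (induction n)
  case (Suc n)
  have "e n \<notin> span (e ` {..<n})"
  proof (cases n)
    case 0 then show ?thesis using e by simp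
  next
    case (Suc m)
    let ?G = "\<lambda>n. span (e ` {..n})"
    have step: "f v - scale (c (Suc k)) v \<in> ?G k" if "v \<in> ?G (Suc k)" for k v
    proof (rule linear_maps_span_into[OF linear_minus_scale[OF f] _ _ that])
      show "(\<lambda>v. f v - scale (c (Suc k)) v) ` e ` {..Suc k} \<subseteq> span (e ` {..k})"
        unfolding image_image
      proof (rule image_subsetI)
        fix i assume "i \<in> {..Suc k}"
        then consider "i = Suc k" | "i \<in> {..k}" by fastforce
        then show "f (e i) - scale (c (Suc k)) (e i) \<in> span (e ` {..k})"
        proof cases
          case 1
          then show ?thesis by (simp add: e span_zero)
        next
          case 2
          then have "e i \<in> span (e ` {..k})" by (intro span_base imageI)
          then show ?thesis by (simp add: e span_diff span_scale)
        qed
      qed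
    qed simp
    have zero: "f v = scale (c 0) v" if "v \<in> ?G 0" for v
    proof -
      have "f v - scale (c 0) v \<in> {0}"
        by (rule linear_maps_span_into[OF linear_minus_scale[OF f] _ _ that]) (auto simp: e)
      then show ?thesis by simp
    qed
    have "e n \<notin> ?G m"
    proof
      assume "e n \<in> ?G m"
      have "\<exists>i\<le>m. c n = c i"
        by (rule triangular_eigenvalue[where G = ?G, OF f subspace_span])
          (fact zero step e \<open>e n \<in> ?G m\<close>)+
      then obtain i where "i \<le> m" "c n = c i" by blast
      then show False using injD[OF inj, of n i] Suc by simp
    qed
    then show ?thesis by (simp add: Suc lessThan_Suc_atMost)
  qed
  moreover from this have "e n \<notin> e ` {..<n}" using span_base[of "e n" "e ` {..<n}"] by argo
  ultimately show ?case using Suc.IH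
    by (simp add: lessThan_Suc card_insert_if independent_insertI)
qed (simp add: independent_empty)

text \<open>Finiteness of the spectrum, in the form that makes strings of eigenvalues of step 2 stop
  in both directions.\<close>

lemma exists_noneigenvalue:
  assumes f: "Vector_Spaces.linear scale scale f" and inj: "inj c"
  shows "\<exists>n :: nat. c n \<notin> eigenvalues f"
proof (rule ccontr)
  assume "\<not> ?thesis"
  then have "\<forall>n. \<exists>v. v \<noteq> 0 \<and> f v = scale (c n) v" by (auto simp: eigenvalues_def)
  then obtain e where e: "\<And>i. e i \<noteq> 0" "\<And>i. f (e i) = scale (c i) (e i)" by metis
  have "independent (e ` {..<Suc dimension})" "card (e ` {..<Suc dimension}) = Suc dimension"
    using independent_eigenvectors[OF f e inj] by auto
  then show False using independent_card_le_dim[of "e ` {..<Suc dimension}" UNIV] by (auto simp: dimension_def)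
qed

end


text \<open>If \<open>p\<close> has least degree among the nonzero polynomials annihilating
  \<open>v\<close> and \<open>p = (t - c) q\<close>, then q(f) v is nonzero by minimality and is an
  eigenvector for \<open>c\<close>.\<close>

lemma exists_eigenvalue:
  fixes scale :: "'k::alg_closed_field \<Rightarrow> 'v::ab_group_add \<Rightarrow> 'v"
  assumes "finite_dimensional_vector_space scale B"
    and f: "Vector_Spaces.linear scale scale f"
    and "\<exists>v::'v. v \<noteq> 0"
  shows "\<exists>c. c \<in> vector_space.eigenvalues scale f"
proof -
  interpret finite_dimensional_vector_space scale B by fact
  interpret f: Vector_Spaces.linear scale scale f by fact
  obtain v :: 'v where v: "v \<noteq> 0" using assms by blast
  define P where "P p \<longleftrightarrow> p \<noteq> 0 \<and> poly_apply f p v = 0" for p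
  obtain p0 where "P p0" unfolding P_def using exists_annihilating_poly[OF f, of v] by blast
  then obtain p where p: "P p" "\<And>q. P q \<Longrightarrow> degree p \<le> degree q"
    using ex_has_least_nat[of P p0 degree] by blast
  have "degree p > 0"
  proof (rule ccontr)
    assume "\<not> ?thesis"
    then obtain a where "p = [:a:]" by (auto elim: degree_eq_zeroE)
    then show False using p(1) v
      by (auto simp: P_def poly_apply_pCons[OF f] poly_apply_0[OF f] f.zero)
  qed
  then obtain c where "poly p c = 0" using alg_closed_imp_poly_has_root by blast
  then obtain q where q: "p = [:- c, 1:] * q" unfolding poly_eq_0_iff_dvd by (rule dvdE)
  then have "q \<noteq> 0" using p(1) by (auto simp: P_def)
  then have "degree p = Suc (degree q)" unfolding q by (subst degree_mult_eq) auto
  then have "\<not> P q" using p(2)[of q] by auto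
  with \<open>q \<noteq> 0\<close> have "poly_apply f q v \<noteq> 0" by (simp add: P_def)
  moreover have "f (poly_apply f q v) = scale c (poly_apply f q v)"
    using p(1) unfolding q P_def poly_apply_linear_factor_mult[OF f] by simp
  ultimately show ?thesis by (auto simp: eigenvalues_def)
qed

section \<open>The spectra of the generators of the tetrahedron algebra\<close>

definition commutator :: "('v \<Rightarrow> 'v) \<Rightarrow> ('v \<Rightarrow> 'v) \<Rightarrow> 'v \<Rightarrow> 'v::ab_group_add" where
  "commutator f g v = f (g v) - g (f v)"

text \<open>The relations are imposed for valid indices only, since elsewhere the generators are
  unspecified. Irreducibility is phrased through the generators alone, so no other element of the
  algebra has to be considered.\<close>

locale irreducible_tetra_ops = finite_dimensional_vector_space scale Basis
  for scale :: "'k::{alg_closed_field, field_char_0} \<Rightarrow> 'v::ab_group_add \<Rightarrow> 'v" and Basis +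
  fixes X :: "nat \<Rightarrow> nat \<Rightarrow> 'v \<Rightarrow> 'v"
  assumes lin: "Vector_Spaces.linear scale scale (X r s)"
    and skew: "{r, s} \<subseteq> tetra_index \<Longrightarrow> distinct [r, s] \<Longrightarrow> X s r v = - X r s v"
    and bracket: "{r, s, t} \<subseteq> tetra_index \<Longrightarrow> distinct [r, s, t] \<Longrightarrow>
      commutator (X r s) (X s t) v = scale 2 (X r s v) + scale 2 (X s t v)"
    and Dolan_Grady: "{r, s, t, u} \<subseteq> tetra_index \<Longrightarrow> distinct [r, s, t, u] \<Longrightarrow>
      commutator (X r s) (commutator (X r s) (commutator (X r s) (X t u))) v =
        scale 4 (commutator (X r s) (X t u) v)"
    and nontrivial: "\<exists>v::'v. v \<noteq> 0"
    and irreducible: "subspace W \<Longrightarrow>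
      (\<And>r s w. {r, s} \<subseteq> tetra_index \<Longrightarrow> r \<noteq> s \<Longrightarrow> w \<in> W \<Longrightarrow> X r s w \<in> W) \<Longrightarrow>
      W = {0} \<or> W = UNIV"
begin

abbreviation E :: "nat \<Rightarrow> nat \<Rightarrow> 'k \<Rightarrow> 'v set" where
  "E r s c \<equiv> eigenspace (X r s) c"

lemma X_simps:
  "X r s (v + w) = X r s v + X r s w" "X r s (scale c v) = scale c (X r s v)"
  "X r s (v - w) = X r s v - X r s w" "X r s (- v) = - X r s v" "X r s 0 = 0"
proof -
  interpret f: Vector_Spaces.linear scale scale "X r s" by (rule lin)
  show "X r s (v + w) = X r s v + X r s w" "X r s (scale c v) = scale c (X r s v)"
    "X r s (v - w) = X r s v - X r s w" "X r s (- v) = - X r s v" "X r s 0 = 0"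
    by (simp_all add: f.add f.scale f.diff f.neg)
qed

lemma E_skew:
  assumes "{r, s} \<subseteq> tetra_index" "r \<noteq> s"
  shows "E s r c = E r s (- c)"
  using skew[of r s] assms by (auto simp: eigenspace_def scale_minus_left minus_equation_iff)

lemma subspace_E: "subspace (E r s c)"
  by (rule subspace_eigenspace[OF lin])

lemma E_trivial: "c \<notin> eigenvalues (X r s) \<Longrightarrow> E r s c = {0}"
  using subspace_0[OF subspace_E] by (auto simp: eigenvalues_iff)

section \<open>Action of the generators on the eigenspaces of one of them\<close>

text \<open>With \<open>X t r = - X r t\<close>, the relation for \<open>X t r\<close> and
  \<open>X r s\<close> says that \<open>X r s - (c - 2)\<close> maps \<open>X r t v\<close> to
  \<open>2 c v\<close>, which is also its value at \<open>c v\<close>.\<close>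

lemma X_lowers_E:
  assumes "{r, s, t} \<subseteq> tetra_index" "distinct [r, s, t]" "v \<in> E r s c"
  shows "X r t v - scale c v \<in> E r s (c - 2)"
proof -
  have v: "X r s v = scale c v" using assms(3) by (simp add: mem_eigenspace_iff)
  have "X t r (X r s v) - X r s (X t r v) = scale 2 (X t r v) + scale 2 (X r s v)"
    using bracket[of t r s v] assms(1,2) by (auto simp: commutator_def)
  moreover have "X t r w = - X r t w" for w using skew[of r t] assms(1,2) by auto
  ultimately have "X r s (X r t v) = scale c (X r t v) - scale 2 (X r t v) + scale 2 (scale c v)"
    by (simp add: v X_simps algebra_simps)
  then show ?thesis
    by (simp add: mem_eigenspace_iff X_simps v algebra_simps)
qed

text \<open>Exchanging \<open>r\<close> and \<open>s\<close> changes the sign of the eigenvalues and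
  so turns lowering into raising.\<close>

lemma X_raises_E:
  assumes "{r, s, t} \<subseteq> tetra_index" "distinct [r, s, t]" "v \<in> E r s c"
  shows "X s t v + scale c v \<in> E r s (c + 2)"
  using X_lowers_E[of s r t v "- c"] E_skew[of r s "- c"] E_skew[of r s "- c - 2"] assms
  by (simp add: add.commute)

lemma Dolan_Grady_E:
  assumes "{r, s, t, u} \<subseteq> tetra_index" "distinct [r, s, t, u]" "v \<in> E r s c"
  shows "X t u v \<in> span (E r s (c - 2) \<union> E r s c \<union> E r s (c + 2))"
proof -
  define a where "a w = X r s w - scale c w" for w
  interpret a: Vector_Spaces.linear scale scale a
    unfolding a_def by (rule linear_minus_scale[OF lin])
  define w where "w = X t u v"
  have v: "X r s v = scale c v" using assms(3) by (simp add: mem_eigenspace_iff)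
  \<comment> \<open>On an eigenvector \<open>v\<close>, commuting an operator with
    \<open>X r s\<close> amounts to applying \<open>a\<close> to its value at
    \<open>v\<close>.\<close>
  have a3: "a (a (a w)) = scale 4 (a w)"
    using Dolan_Grady[OF assms(1,2), of v]
    by (simp add: commutator_def X_simps v w_def a_def algebra_simps)
  have mem: "y \<in> E r s (c + k) \<longleftrightarrow> a y = scale k y" for y k
    by (auto simp: mem_eigenspace_iff a_def scale_left_distrib algebra_simps)
  \<comment> \<open>Since \<open>a\<close> satisfies \<open>t\<^sup>3 = 4 t\<close> on \<open>w\<close>, its spectral projections for
    \<open>0, 2, -2\<close> give the three components of \<open>w\<close>, up to scalars.\<close>
  define u0 where "u0 = a (a w) - scale 4 w"
  define up where "up = a (a w) + scale 2 (a w)"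
  define um where "um = a (a w) - scale 2 (a w)"
  have "a u0 = 0" by (simp add: u0_def a.diff a.scale a3)
  then have u0: "u0 \<in> E r s c" using mem[of _ 0] by simp
  have up: "up \<in> E r s (c + 2)"
    unfolding mem up_def by (simp add: a.add a.scale a3 scale_right_distrib)
  have "um \<in> E r s (c + (- 2))"
    unfolding mem um_def
    by (simp add: a.diff a.scale a3 scale_right_diff_distrib)
  then have um: "um \<in> E r s (c - 2)" by simp
  have "scale 8 w = up + um - scale 2 u0"
    by (simp add: up_def um_def u0_def scale_right_diff_distrib scale_left_distrib[of 1 1, simplified])
  then have "scale (1/8) (scale 8 w) = scale (1/8) (up + um - scale 2 u0)" by simp
  then have "w = scale (1/8) (up + um - scale 2 u0)" by simp
  also have "\<dots> \<in> span (E r s (c - 2) \<union> E r s c \<union> E r s (c + 2))"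
    using u0 up um by (intro span_scale span_diff span_add) (auto intro: span_base)
  finally show ?thesis by (simp add: w_def)
qed

text \<open>Either \<open>a, b\<close> shares an index with \<open>r, s\<close>, and lowering or
  raising applies up to sign, or it is the complementary pair, and the Dolan-Grady relation
  applies.\<close>

lemma X_E_subset:
  assumes rs: "{r, s} \<subseteq> tetra_index" "r \<noteq> s" and ab: "{a, b} \<subseteq> tetra_index" "a \<noteq> b"
    and v: "v \<in> E r s c"
  shows "X a b v \<in> span (E r s (c - 2) \<union> E r s c \<union> E r s (c + 2))" (is "_ \<in> ?S")
proof -
  have vS: "v \<in> ?S" using v by (auto intro: span_base)
  have rt: "X r t v \<in> ?S" if "t \<in> tetra_index" "t \<noteq> r" for t
  proof (cases "t = s")
    case True
    then show ?thesis using v vS by (simp add: mem_eigenspace_iff span_scale)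
  next
    case False
    then have "X r t v - scale c v \<in> ?S"
      using X_lowers_E[of r s t v c] that rs v by (auto intro: span_base)
    from span_add[OF this span_scale[OF vS, of c]] show ?thesis by simp
  qed
  have st: "X s t v \<in> ?S" if "t \<in> tetra_index" "t \<noteq> s" for t
  proof (cases "t = r")
    case True
    then show ?thesis
      using v span_neg[OF span_scale[OF vS, of c]] skew[of r s v] rs
      by (simp add: mem_eigenspace_iff)
  next
    case False
    then have "X s t v + scale c v \<in> ?S"
      using X_raises_E[of r s t v c] that rs v by (auto intro: span_base)
    from span_diff[OF this span_scale[OF vS, of c]] show ?thesis by simp
  qed
  have flip: "X a b v = - X b a v" using skew[of b a v] ab by auto
  consider "a = r" | "b = r" | "a = s" | "b = s" | "distinct [r, s, a, b]"
    using rs ab by auto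
  then show ?thesis
  proof cases
    case 1
    then show ?thesis using rt[of b] ab by simp
  next
    case 2
    then show ?thesis using span_neg[OF rt[of a]] flip ab by simp
  next
    case 3
    then show ?thesis using st[of b] ab by simp
  next
    case 4
    then show ?thesis using span_neg[OF st[of a]] flip ab by simp
  next
    case 5
    then show ?thesis using Dolan_Grady_E[of r s a b v c] rs ab v by auto
  qed
qed

text \<open>The span is invariant under all generators: a neighbour \<open>c - 2\<close> or
  \<open>c + 2\<close> outside \<open>S\<close> is no eigenvalue, so its eigenspace is zero.
  Irreducibility does the rest.\<close>

lemma span_closed_eigenspaces:
  assumes rs: "{r, s} \<subseteq> tetra_index" "r \<noteq> s"
    and closed: "\<And>c c'. c \<in> S \<Longrightarrow> c' \<in> {c - 2, c + 2} \<Longrightarrow> c' \<in> eigenvalues (X r s) \<Longrightarrow> c' \<in> S"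
    and c0: "c0 \<in> S" "c0 \<in> eigenvalues (X r s)"
  shows "span (\<Union>c\<in>S. E r s c) = UNIV" (is "?W = UNIV")
proof -
  have sub: "E r s c' \<subseteq> ?W" if "c \<in> S" "c' \<in> {c - 2, c, c + 2}" for c c'
  proof (cases "c' \<in> S")
    case True then show ?thesis by (auto intro: span_base)
  next
    case False
    then have "c' \<notin> eigenvalues (X r s)" using closed that by blast
    then show ?thesis using E_trivial span_zero by auto
  qed
  have "X a b w \<in> ?W" if ab: "{a, b} \<subseteq> tetra_index" "a \<noteq> b" and w: "w \<in> ?W" for a b w
  proof (rule linear_maps_span_into[OF lin subspace_span _ w], safe)
    fix v c assume c: "c \<in> S" and v: "v \<in> E r s c"
    have "span (E r s (c - 2) \<union> E r s c \<union> E r s (c + 2)) \<subseteq> ?W"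
      using sub[OF c] by (intro span_minimal) auto
    with X_E_subset[OF rs ab v] show "X a b v \<in> ?W" by blast
  qed
  moreover have "?W \<noteq> {0}"
    using c0 unfolding eigenvalues_iff by (auto intro: span_base)
  ultimately show ?thesis using irreducible[OF subspace_span] by blast
qed

section \<open>Flags of eigenspaces and the spectra\<close>

text \<open>Meant for the lowest eigenvalue \<open>c\<close>; scalars that are not eigenvalues
  contribute only zero.\<close>

definition flag :: "nat \<Rightarrow> nat \<Rightarrow> 'k \<Rightarrow> nat \<Rightarrow> 'v set" where
  "flag r s c n = span (\<Union>i\<le>n. E r s (c + 2 * of_nat i))"

lemma subspace_flag: "subspace (flag r s c n)"
  by (simp add: flag_def)

lemma flag_mono: "m \<le> n \<Longrightarrow> flag r s c m \<subseteq> flag r s c n"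
  unfolding flag_def by (intro span_mono UN_mono) auto

lemma E_subset_flag: "i \<le> n \<Longrightarrow> E r s (c + 2 * of_nat i) \<subseteq> flag r s c n"
  unfolding flag_def by (auto intro: span_base)

text \<open>\<open>X r t - \<mu>\<close> sends the \<open>\<mu>\<close>-eigenspace of
  \<open>X r s\<close> to that of \<open>\<mu> - 2\<close>, or to zero if \<open>t = s\<close>, and
  below \<open>c\<close> there is nothing. Allowing \<open>t = s\<close> covers \<open>X r s\<close>
  itself.\<close>

lemma flag_triangular:
  assumes "{r, s, t} \<subseteq> tetra_index" "r \<noteq> s" "r \<noteq> t" and bot: "c - 2 \<notin> eigenvalues (X r s)"
  shows "v \<in> flag r s c 0 \<Longrightarrow> X r t v = scale (c + 2 * of_nat 0) v"
    and "v \<in> flag r s c (Suc n) \<Longrightarrow> X r t v - scale (c + 2 * of_nat (Suc n)) v \<in> flag r s c n"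
proof -
  have low: "X r t e - scale \<mu> e \<in> E r s (\<mu> - 2)" if "e \<in> E r s \<mu>" for e \<mu>
  proof (cases "t = s")
    case True
    then show ?thesis using that subspace_0[OF subspace_E] by (simp add: mem_eigenspace_iff)
  next
    case False
    then show ?thesis using X_lowers_E[of r s t] assms that by auto
  qed
  show "X r t v = scale (c + 2 * of_nat 0) v" if "v \<in> flag r s c 0"
  proof -
    have "v \<in> E r s c"
      using that span_minimal[OF subset_refl subspace_E, of r s c] by (auto simp: flag_def)
    then have "X r t v - scale c v = 0" using low E_trivial[OF bot] by blast
    then show ?thesis by simp
  qed
  show "X r t v - scale (c + 2 * of_nat (Suc n)) v \<in> flag r s c n" if v: "v \<in> flag r s c (Suc n)"
  proof (rule linear_maps_span_into[OF linear_minus_scale[OF lin] subspace_flag _ v[unfolded flag_def]],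
      safe)
    fix i e assume i: "i \<le> Suc n" and e: "e \<in> E r s (c + 2 * of_nat i)"
    have "X r t e - scale (c + 2 * of_nat i) e \<in> flag r s c n"
    proof (cases i)
      case 0
      then show ?thesis using low[OF e] E_trivial[OF bot] subspace_0[OF subspace_flag] by auto
    next
      case (Suc j)
      then show ?thesis using low[OF e] i E_subset_flag[of j n r s c] by (auto simp: algebra_simps)
    qed
    \<comment> \<open>The diagonal entry for \<open>i\<close> is traded for the one for
      \<open>Suc n\<close>; the difference vanishes exactly at \<open>i = Suc n\<close>, the only
      index whose eigenspace need not lie in \<open>flag r s c n\<close>.\<close>
    moreover have "scale (2 * of_nat i - 2 * of_nat (Suc n)) e \<in> flag r s c n"
    proof (cases "i = Suc n")
      case True
      then show ?thesis using subspace_0[OF subspace_flag] by simp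
    next
      case False
      then show ?thesis using E_subset_flag[of i n r s c] i e by (auto intro!: subspace_scale[OF subspace_flag])
    qed
    ultimately have "X r t e - scale (c + 2 * of_nat i) e + scale (2 * of_nat i - 2 * of_nat (Suc n)) e
        \<in> flag r s c n"
      by (rule subspace_add[OF subspace_flag])
    moreover have "X r t e - scale (c + 2 * of_nat i) e + scale (2 * of_nat i - 2 * of_nat (Suc n)) e =
        X r t e - scale (c + 2 * of_nat (Suc n)) e"
      by (simp add: scale_left_distrib scale_left_diff_distrib del: of_nat_Suc)
    ultimately show "X r t e - scale (c + 2 * of_nat (Suc n)) e \<in> flag r s c n" by (simp only:)
  qed
qed

lemma eigenvalue_in_flag:
  assumes "{r, s, t} \<subseteq> tetra_index" "r \<noteq> s" "r \<noteq> t" "c - 2 \<notin> eigenvalues (X r s)"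
    and "v \<in> flag r s c n" "v \<noteq> 0" "v \<in> E r t \<mu>"
  shows "\<exists>i\<le>n. \<mu> = c + 2 * of_nat i"
  by (rule triangular_eigenvalue[where G = "flag r s c" and c = "\<lambda>i. c + 2 * of_nat i",
        OF lin subspace_flag])
    (use flag_triangular[OF assms(1-4)] assms(5-7) in \<open>auto simp only: mem_eigenspace_iff\<close>)

text \<open>The string of step 2 through one eigenvalue is closed under neighbouring eigenvalues, so
  its eigenspaces span everything and no eigenvalue is left outside.\<close>

lemma eigenvalues_arithmetic:
  assumes rs: "{r, s} \<subseteq> tetra_index" "r \<noteq> s"
  obtains c d where "c - 2 \<notin> eigenvalues (X r s)"
    "eigenvalues (X r s) = {c + 2 * of_nat i | i. i \<le> d}" "flag r s c d = UNIV"
proof -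
  let ?S = "eigenvalues (X r s)"
  obtain c0 where c0: "c0 \<in> ?S"
    using exists_eigenvalue[OF finite_dimensional_vector_space_axioms lin nontrivial] by blast
  \<comment> \<open>First gap below \<open>c0\<close>; it is not at 0, so its predecessor
    \<open>m'\<close> yields the lowest eigenvalue \<open>c\<close> of the string. The top
    \<open>d\<close> is found likewise from the first gap above \<open>c\<close>.\<close>
  define m where "m = (LEAST n. c0 - 2 * of_nat n \<notin> ?S)"
  have "\<exists>n. c0 - 2 * of_nat n \<notin> ?S"
    using exists_noneigenvalue[OF lin, of "\<lambda>n. c0 - 2 * of_nat n"] by (auto simp: inj_def)
  then have m: "c0 - 2 * of_nat m \<notin> ?S" unfolding m_def by (rule LeastI_ex)
  then obtain m' where m': "m = Suc m'" using c0 by (cases m) auto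
  define c where "c = c0 - 2 * of_nat m'"
  have cS: "c \<in> ?S" unfolding c_def using not_less_Least[of m' "\<lambda>n. c0 - 2 * of_nat n \<notin> ?S"] m'
    unfolding m_def by auto
  have bot: "c - 2 \<notin> ?S" using m unfolding m' c_def by (simp add: algebra_simps)
  define k where "k = (LEAST n. c + 2 * of_nat n \<notin> ?S)"
  have "\<exists>n. c + 2 * of_nat n \<notin> ?S"
    using exists_noneigenvalue[OF lin, of "\<lambda>n. c + 2 * of_nat n"] by (auto simp: inj_def)
  then have k: "c + 2 * of_nat k \<notin> ?S" unfolding k_def by (rule LeastI_ex)
  then obtain d where d: "k = Suc d" using cS by (cases k) auto
  have le: "c + 2 * of_nat i \<in> ?S" if "i \<le> d" for i
    using not_less_Least[of i "\<lambda>n. c + 2 * of_nat n \<notin> ?S"] that d unfolding k_def by auto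
  let ?T = "{c + 2 * of_nat i | i. i \<le> d}"
  have "span (\<Union>c\<in>?T. E r s c) = UNIV"
  proof (rule span_closed_eigenspaces[OF rs _ _ cS])
    fix x y assume "x \<in> ?T" and y: "y \<in> {x - 2, x + 2}" "y \<in> ?S"
    then obtain i where i: "i \<le> d" "x = c + 2 * of_nat i" by blast
    from y(1) consider "y = x - 2" | "y = x + 2" by blast
    then show "y \<in> ?T"
    proof cases
      case 1
      with i y bot obtain j where "i = Suc j" by (cases i) auto
      with 1 i show ?thesis by (intro CollectI exI[of _ j]) (auto simp: algebra_simps)
    next
      case 2
      then have "y = c + 2 * of_nat (Suc i)" using i by (simp add: algebra_simps)
      moreover from this have "i \<noteq> d" using y k d by auto
      ultimately show ?thesis using i by (intro CollectI exI[of _ "Suc i"]) auto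
    qed
  qed (auto intro!: exI[of _ 0])
  moreover have "(\<Union>c\<in>?T. E r s c) = (\<Union>i\<le>d. E r s (c + 2 * of_nat i))" by auto
  ultimately have flag: "flag r s c d = UNIV" by (simp add: flag_def)
  \<comment> \<open>Triangularity of \<open>X r s\<close> on its own flag, which is the whole
    space.\<close>
  have "\<mu> \<in> ?T" if "\<mu> \<in> ?S" for \<mu>
    using that eigenvalue_in_flag[of r s s c _ d \<mu>] rs bot flag unfolding eigenvalues_iff by auto
  then have "?S = ?T" using le by auto
  with bot flag show thesis using that by blast
qed

text \<open>\<open>X r t\<close> is triangular on the flag of \<open>X r s\<close>, which exhausts
  the space and has the eigenvalues of \<open>X r s\<close> on the diagonal.\<close>

lemma eigenvalues_subset:
  assumes "{r, s, t} \<subseteq> tetra_index" "r \<noteq> s" "r \<noteq> t"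
  shows "eigenvalues (X r t) \<subseteq> eigenvalues (X r s)"
proof -
  obtain c d where cd: "c - 2 \<notin> eigenvalues (X r s)"
    "eigenvalues (X r s) = {c + 2 * of_nat i | i. i \<le> d}" "flag r s c d = UNIV"
    using eigenvalues_arithmetic[of r s] assms by auto
  have "\<mu> \<in> eigenvalues (X r s)" if "\<mu> \<in> eigenvalues (X r t)" for \<mu>
    using that eigenvalue_in_flag[OF assms cd(1), of _ d \<mu>] cd(2,3) unfolding eigenvalues_iff[of _ "X r t"]
    by auto
  then show ?thesis by blast
qed

lemma eigenvalues_eq:
  assumes "{r, s, t} \<subseteq> tetra_index" "r \<noteq> s" "r \<noteq> t"
  shows "eigenvalues (X r t) = eigenvalues (X r s)"
  using eigenvalues_subset[of r s t] eigenvalues_subset[of r t s] assms by auto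

lemma eigenvalues_skew:
  assumes "{r, s} \<subseteq> tetra_index" "r \<noteq> s"
  shows "eigenvalues (X s r) = uminus ` eigenvalues (X r s)"
proof -
  have "\<mu> \<in> eigenvalues (X s r) \<longleftrightarrow> - \<mu> \<in> eigenvalues (X r s)" for \<mu>
    using E_skew[OF assms] by (simp add: eigenvalues_iff)
  then show ?thesis by (force simp: image_iff)
qed

text \<open>A detour through a third index \<open>t\<close> replaces one sign change by two, which
  cancel.\<close>

lemma eigenvalues_symmetric:
  assumes "{r, s} \<subseteq> tetra_index" "r \<noteq> s"
  shows "eigenvalues (X s r) = eigenvalues (X r s)"
proof -
  obtain t where t: "t \<in> tetra_index" "t \<noteq> r" "t \<noteq> s"
  proof -
    have "\<not> tetra_index \<subseteq> {r, s}"
      using card_mono[of "{r, s}" tetra_index] by (auto simp: tetra_index_def card_insert_if split: if_splits)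
    then show thesis using that by blast
  qed
  have "eigenvalues (X s r) = eigenvalues (X s t)" using eigenvalues_eq[of s t r] assms t by auto
  also have "\<dots> = uminus ` eigenvalues (X t s)" using eigenvalues_skew[of t s] assms t by auto
  also have "eigenvalues (X t s) = eigenvalues (X t r)" using eigenvalues_eq[of t r s] assms t by auto
  also have "uminus ` eigenvalues (X t r) = eigenvalues (X r t)"
    using eigenvalues_skew[of t r] assms t by auto
  also have "\<dots> = eigenvalues (X r s)" using eigenvalues_eq[of r s t] assms t by auto
  finally show ?thesis .
qed

lemma eigenvalues_X01:
  assumes "{r, s} \<subseteq> tetra_index" "r \<noteq> s"
  shows "eigenvalues (X r s) = eigenvalues (X 0 1)"
proof (cases "r = 0")
  case True
  then show ?thesis using eigenvalues_eq[of 0 1 s] assms by (auto simp: tetra_index_def)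
next
  case False
  then have "eigenvalues (X r s) = eigenvalues (X r 0)"
    using eigenvalues_eq[of r 0 s] assms by (auto simp: tetra_index_def)
  also have "\<dots> = eigenvalues (X 0 r)"
    using eigenvalues_symmetric[of 0 r] False assms by (auto simp: tetra_index_def)
  also have "\<dots> = eigenvalues (X 0 1)"
    using eigenvalues_eq[of 0 1 r] False assms by (auto simp: tetra_index_def)
  finally show ?thesis .
qed

lemma common_eigenvalues:
  obtains d where "\<And>r s. {r, s} \<subseteq> tetra_index \<Longrightarrow> r \<noteq> s \<Longrightarrow>
    eigenvalues (X r s) = {- of_nat d + 2 * of_nat i | i. i \<le> d} \<and> flag r s (- of_nat d) d = UNIV"
proof -
  have I: "{0, 1} \<subseteq> tetra_index" by (simp add: tetra_index_def)
  obtain c d where cd: "c - 2 \<notin> eigenvalues (X 0 1)"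
    "eigenvalues (X 0 1) = {c + 2 * of_nat i | i. i \<le> d}"
    by (rule eigenvalues_arithmetic[OF I]) auto
  have neg: "- \<mu> \<in> eigenvalues (X 0 1)" if "\<mu> \<in> eigenvalues (X 0 1)" for \<mu>
    using that eigenvalues_symmetric[OF I] eigenvalues_skew[OF I] by auto
  have "c \<in> eigenvalues (X 0 1)" unfolding cd(2) by (intro CollectI exI[of _ 0]) auto
  \<comment> \<open>Negating the lower end gives \<open>c = - j\<close> with
    \<open>j \<le> d\<close>; negating the upper end gives \<open>j = d + i\<close>. Hence
    \<open>j = d\<close>.\<close>
  from neg[OF this] obtain j where j: "j \<le> d" "- c = c + 2 * of_nat j" unfolding cd(2) by blast
  then have "2 * (c + of_nat j) = 0" by (simp add: algebra_simps)
  then have "c + of_nat j = 0" by (simp only: mult_eq_0_iff) simp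
  then have cj: "c = - of_nat j" by (simp add: eq_neg_iff_add_eq_0)
  have "c + 2 * of_nat d \<in> eigenvalues (X 0 1)" unfolding cd(2) by blast
  from neg[OF this] obtain i where i: "i \<le> d" "- (c + 2 * of_nat d) = c + 2 * of_nat i"
    unfolding cd(2) by blast
  then have "2 * of_nat j = (2 * of_nat d + 2 * of_nat i :: 'k)" by (simp add: cj algebra_simps)
  then have "(of_nat (2 * j) :: 'k) = of_nat (2 * d + 2 * i)" by simp
  then have "2 * j = 2 * d + 2 * i" by (simp only: of_nat_eq_iff)
  then have c: "c = - of_nat d" using j(1) cj by simp
  show thesis
  proof (rule that)
    fix r s :: nat assume rs: "{r, s} \<subseteq> tetra_index" "r \<noteq> s"
    obtain c' d' where cd': "c' - 2 \<notin> eigenvalues (X r s)"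
      "eigenvalues (X r s) = {c' + 2 * of_nat i | i. i \<le> d'}" "flag r s c' d' = UNIV"
      using eigenvalues_arithmetic[OF rs] by blast
    have spec: "eigenvalues (X r s) = {- of_nat d + 2 * of_nat i | i. i \<le> d}"
      using cd(2) eigenvalues_X01[OF rs] c by simp
    \<comment> \<open>Both full flags are the span of all eigenspaces, however the spectrum is
      indexed.\<close>
    have "(\<Union>i\<le>d'. E r s (c' + 2 * of_nat i)) = (\<Union>\<mu>\<in>eigenvalues (X r s). E r s \<mu>)"
      unfolding cd'(2) by auto
    also have "\<dots> = (\<Union>i\<le>d. E r s (- of_nat d + 2 * of_nat i))" unfolding spec by auto
    finally have "flag r s (- of_nat d) d = UNIV" using cd'(3) by (simp add: flag_def)
    with spec show "eigenvalues (X r s) = {- of_nat d + 2 * of_nat i | i. i \<le> d} \<and>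
        flag r s (- of_nat d) d = UNIV" by blast
  qed
qed

end

section \<open>The four flags\<close>

locale irreducible_tetra_ops_diameter = irreducible_tetra_ops scale Basis X
  for scale :: "'k::{alg_closed_field, field_char_0} \<Rightarrow> 'v::ab_group_add \<Rightarrow> 'v" and Basis X +
  fixes d :: nat
  assumes spectrum: "{r, s} \<subseteq> tetra_index \<Longrightarrow> r \<noteq> s \<Longrightarrow>
      eigenvalues (X r s) = {- of_nat d + 2 * of_nat i | i. i \<le> d}"
    and flag_full: "{r, s} \<subseteq> tetra_index \<Longrightarrow> r \<noteq> s \<Longrightarrow> flag r s (- of_nat d) d = UNIV"
begin

text \<open>The eigenvalues counted from the bottom; an eigenvalue only for
  \<open>i \<le> d\<close>.\<close>

definition wt :: "nat \<Rightarrow> 'k" where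
  "wt i = - of_nat d + 2 * of_nat i"

abbreviation F :: "nat \<Rightarrow> nat \<Rightarrow> nat \<Rightarrow> 'v set" where
  "F r s n \<equiv> flag r s (- of_nat d) n"

lemma wt_eq_iff: "wt i = wt j \<longleftrightarrow> i = j"
  by (simp add: wt_def)

lemma wt_Suc: "wt (Suc i) = wt i + 2"
  by (simp add: wt_def algebra_simps)

lemma uminus_wt: "i \<le> d \<Longrightarrow> - wt i = wt (d - i)"
  by (simp add: wt_def of_nat_diff algebra_simps)

lemma below_spectrum:
  assumes "{r, s} \<subseteq> tetra_index" "r \<noteq> s"
  shows "- of_nat d - 2 \<notin> eigenvalues (X r s)"
proof
  assume "- of_nat d - 2 \<in> eigenvalues (X r s)"
  then obtain i where "- of_nat d - 2 = (- of_nat d + 2 * of_nat i :: 'k)"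
    unfolding spectrum[OF assms] by blast
  then have "2 * of_nat (Suc i) = (0 :: 'k)" by (simp add: algebra_simps)
  then show False by (simp del: of_nat_Suc)
qed

lemma E_wt_skew:
  assumes "{r, s} \<subseteq> tetra_index" "r \<noteq> s" "i \<le> d"
  shows "E s r (wt (d - i)) = E r s (wt i)"
  using E_skew[OF assms(1,2), of "wt (d - i)"] uminus_wt[of "d - i"] assms(3) by simp

lemma E_wt_subset_F: "i \<le> n \<Longrightarrow> E r s (wt i) \<subseteq> F r s n"
  unfolding wt_def by (rule E_subset_flag)

text \<open>Lets lowering be treated uniformly: below \<open>wt 0\<close> the eigenspace is zero and
  any \<open>j\<close> serves.\<close>

lemma E_wt_pred:
  assumes "{r, s} \<subseteq> tetra_index" "r \<noteq> s"
  shows "\<exists>j. E r s (wt i - 2) \<subseteq> E r s (wt j)"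
proof (cases i)
  case 0
  then have "E r s (wt i - 2) = {0}"
    using E_trivial[OF below_spectrum[OF assms]] by (simp add: wt_def)
  then show ?thesis using subspace_0[OF subspace_E] by auto
next
  case (Suc j)
  then show ?thesis by (intro exI[of _ j]) (simp add: wt_Suc)
qed

lemma F_triangular:
  assumes "{r, s, t} \<subseteq> tetra_index" "r \<noteq> s" "r \<noteq> t"
  shows "v \<in> F r s 0 \<Longrightarrow> X r t v = scale (wt 0) v"
    and "v \<in> F r s (Suc n) \<Longrightarrow> X r t v - scale (wt (Suc n)) v \<in> F r s n"
  unfolding wt_def using flag_triangular[OF assms below_spectrum] assms by auto

section \<open>Dependence of the flags on one index, and their opposition\<close>

text \<open>\<open>X r t\<close> acts on the subspaces \<open>W \<inter> F r s n\<close>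
  triangularly with distinct diagonal entries.\<close>

lemma invariant_subspace_span:
  assumes rst: "{r, s, t} \<subseteq> tetra_index" "r \<noteq> s" "r \<noteq> t"
    and W: "subspace W" "\<And>w. w \<in> W \<Longrightarrow> X r t w \<in> W"
  shows "W \<inter> F r s n \<subseteq> span (\<Union>i\<le>n. W \<inter> F r s n \<inter> E r t (wt i))"
proof (rule triangular_eigenspace_span[where G = "\<lambda>n. W \<inter> F r s n", OF lin])
  show "X r t v - scale (wt (Suc n)) v \<in> W \<inter> F r s n" if "v \<in> W \<inter> F r s (Suc n)" for n v
    using F_triangular(2)[OF rst, of v n] that W by (auto intro: subspace_diff subspace_scale)
  show "W \<inter> F r s n \<subseteq> W \<inter> F r s (Suc n)" for n
    using flag_mono[of n "Suc n" r s "- of_nat d"] by auto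
qed (use F_triangular(1)[OF rst] W subspace_flag subspace_inter in \<open>auto simp: wt_eq_iff inj_def\<close>)

text \<open>\<open>F r s n\<close> is spanned by eigenvectors of \<open>X r t\<close> for the same
  weights. Exchanging \<open>s\<close> and \<open>t\<close> gives equality, so the flag depends on
  \<open>r\<close> only.\<close>

lemma F_subset:
  assumes "{r, s, t} \<subseteq> tetra_index" "r \<noteq> s" "r \<noteq> t"
  shows "F r s n \<subseteq> F r t n"
proof -
  have "F r s n \<subseteq> span (\<Union>i\<le>n. F r s n \<inter> E r t (wt i))"
    using invariant_subspace_span[OF assms, of UNIV n] by simp
  also have "\<dots> \<subseteq> F r t n"
    using E_wt_subset_F by (intro span_minimal subspace_flag) blast
  finally show ?thesis .
qed

text \<open>For \<open>X r s\<close>, the first flag has weights \<open>wt 0\<close> to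
  \<open>wt n\<close>, the second \<open>wt (d - m)\<close> to \<open>wt d\<close>; these ranges
  share at most one weight.\<close>

lemma opposite_flags:
  assumes rs: "{r, s} \<subseteq> tetra_index" "r \<noteq> s" and le: "n + m \<le> d"
    and v: "v \<in> F r s n" "v \<in> F s r m"
  shows "v \<in> E r s (wt n)" "n + m < d \<Longrightarrow> v = 0"
proof -
  \<comment> \<open>Invariance of the second flag allows decomposing its intersection with the first
    into eigenvectors of \<open>X r s\<close>.\<close>
  have inv: "X r s w \<in> F s r m" if w: "w \<in> F s r m" for w
  proof (rule linear_maps_span_into[OF lin subspace_flag _ w[unfolded flag_def]], safe)
    fix i e assume i: "i \<le> m" and e: "e \<in> E s r (- of_nat d + 2 * of_nat i)"
    have "X r s e = - scale (- of_nat d + 2 * of_nat i) e"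
      using skew[of s r e] rs e by (simp add: mem_eigenspace_iff)
    then show "X r s e \<in> F s r m"
      using e E_subset_flag[OF i, of s r "- of_nat d"]
      by (auto intro: subspace_neg[OF subspace_flag] subspace_scale[OF subspace_flag])
  qed
  \<comment> \<open>For \<open>X s r\<close> the index of \<open>e\<close> is \<open>d - i\<close>,
    so membership in \<open>F s r m\<close> forces \<open>d - i \<le> m\<close>, whence
    \<open>d \<le> i + m \<le> n + m \<le> d\<close>.\<close>
  have *: "e = 0 \<or> (i = n \<and> n + m = d)" if e: "i \<le> n" "e \<in> F s r m" "e \<in> E r s (wt i)" for i e
  proof (unfold disj_imp, rule impI)
    assume "e \<noteq> 0"
    have i: "i \<le> d" using e(1) le by simp
    then have "e \<in> E s r (wt (d - i))" using e(3) E_wt_skew rs by simp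
    have sr: "{s, r, r} \<subseteq> tetra_index" "s \<noteq> r" "{s, r} \<subseteq> tetra_index" using rs by auto
    obtain j where "j \<le> m" "wt (d - i) = wt j"
      using eigenvalue_in_flag[OF sr(1,2,2) below_spectrum[OF sr(3,2)] e(2) \<open>e \<noteq> 0\<close>
          \<open>e \<in> E s r (wt (d - i))\<close>] unfolding wt_def by blast
    then show "i = n \<and> n + m = d" using e(1) le i unfolding wt_eq_iff by linarith
  qed
  have "v \<in> span (\<Union>i\<le>n. F s r m \<inter> F r s n \<inter> E r s (wt i))" (is "_ \<in> span ?A")
    using invariant_subspace_span[of r s s "F s r m" n] rs inv subspace_flag v by auto
  moreover have "?A \<subseteq> E r s (wt n)" using * subspace_0[OF subspace_E] by blast
  then have "span ?A \<subseteq> E r s (wt n)" by (rule span_minimal[OF _ subspace_E])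
  moreover have "span ?A \<subseteq> {0}" if "n + m < d"
    using * that by (intro span_minimal) auto
  ultimately show "v \<in> E r s (wt n)" "n + m < d \<Longrightarrow> v = 0" by auto
qed

section \<open>Lowest weights on an invariant subspace\<close>

text \<open>An index, not an eigenvalue; meaningful only if \<open>W\<close> contains an eigenvector
  of \<open>X r s\<close> of some weight \<open>wt i\<close>.\<close>

definition low :: "'v set \<Rightarrow> nat \<Rightarrow> nat \<Rightarrow> nat" where
  "low W r s = (LEAST i. W \<inter> E r s (wt i) \<noteq> {0})"

context
  fixes W :: "'v set"
  assumes W: "subspace W" and nonzero: "W \<noteq> {0}"
begin

lemma low_props:
  assumes rs: "{r, s} \<subseteq> tetra_index" "r \<noteq> s" and inv: "\<And>w. w \<in> W \<Longrightarrow> X r s w \<in> W"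
  shows "low W r s \<le> d" "\<exists>w. w \<noteq> 0 \<and> w \<in> W \<and> w \<in> E r s (wt (low W r s))"
    "W \<subseteq> F s r (d - low W r s)"
proof -
  let ?P = "\<lambda>i. W \<inter> E r s (wt i) \<noteq> {0}"
  have span: "W \<subseteq> span (\<Union>i\<le>d. W \<inter> E r s (wt i))"
    using invariant_subspace_span[of r s s W d] rs W inv by (simp add: flag_full)
  have ex: "\<exists>i\<le>d. ?P i"
  proof (rule ccontr)
    assume "\<not> ?thesis"
    then have "W \<subseteq> span {0}"
      using span span_mono[of "\<Union>i\<le>d. W \<inter> E r s (wt i)" "{0}"] by blast
    then show False using nonzero subspace_0[OF W] by auto
  qed
  then obtain i where i: "i \<le> d" "?P i" by blast
  then have "?P (low W r s)" unfolding low_def by (intro LeastI[of ?P])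
  moreover have "0 \<in> W \<inter> E r s (wt (low W r s))"
    using subspace_0[OF W] subspace_0[OF subspace_E] by blast
  ultimately show "\<exists>w. w \<noteq> 0 \<and> w \<in> W \<and> w \<in> E r s (wt (low W r s))" by blast
  from i show "low W r s \<le> d" unfolding low_def using Least_le[of ?P i] by linarith
  \<comment> \<open>Index \<open>i\<close> for \<open>X r s\<close> is index \<open>d - i\<close>
    for \<open>X s r\<close>, so a lower bound on \<open>i\<close> becomes membership in a
    flag.\<close>
  have "W \<inter> E r s (wt i) \<subseteq> F s r (d - low W r s)" if "i \<le> d" for i
  proof (cases "?P i")
    case True
    then have "low W r s \<le> i" unfolding low_def by (rule Least_le)
    then show ?thesis
      using E_wt_subset_F[of "d - i" "d - low W r s" s r] E_wt_skew[OF rs \<open>i \<le> d\<close>]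
      by (simp add: diff_le_mono2 le_infI2)
  next
    case False
    then show ?thesis using subspace_0[OF subspace_flag] by auto
  qed
  then have "span (\<Union>i\<le>d. W \<inter> E r s (wt i)) \<subseteq> F s r (d - low W r s)"
    by (intro span_minimal subspace_flag) auto
  with span show "W \<subseteq> F s r (d - low W r s)" by blast
qed

text \<open>As flags depend on the first index only, \<open>F r r'\<close> may be replaced by
  \<open>F r s\<close>, and the flag \<open>F s s'\<close> containing \<open>W\<close> by
  \<open>F s r\<close>.\<close>

lemma low_vector_flags:
  assumes idx: "{r, r', s, s'} \<subseteq> tetra_index" "distinct [r, r', s, s']"
    and inv: "\<And>w. w \<in> W \<Longrightarrow> X s' s w \<in> W"
    and w: "w \<in> W" "w \<in> E r r' (wt p)"
  shows "w \<in> F r s p" "w \<in> F s r (d - low W s' s)"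
proof -
  have "w \<in> F r r' p" using w E_wt_subset_F by blast
  then show "w \<in> F r s p" using F_subset[of r r' s p] idx by auto
  have "w \<in> F s s' (d - low W s' s)" using low_props(3)[of s' s] inv w idx by auto
  then show "w \<in> F s r (d - low W s' s)" using F_subset[of s s' r] idx by auto
qed

text \<open>
  The lowest eigenvector of \<open>X r r'\<close> in \<open>W\<close> lies in two flags that meet trivially unless the
  inequality holds; by the symmetry of the hypotheses the inequality becomes an equality, and then
  the two flags meet in an eigenspace of \<open>X r s\<close>.
\<close>

lemma low_le:
  assumes idx: "{r, r', s, s'} \<subseteq> tetra_index" "distinct [r, r', s, s']"
    and inv: "\<And>w. w \<in> W \<Longrightarrow> X r r' w \<in> W" "\<And>w. w \<in> W \<Longrightarrow> X s' s w \<in> W"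
  shows "low W s' s \<le> low W r r'"
proof (rule ccontr)
  assume less: "\<not> ?thesis"
  obtain w where w: "w \<noteq> 0" "w \<in> W" "w \<in> E r r' (wt (low W r r'))"
    using low_props(2)[of r r'] idx inv by auto
  have "low W s' s \<le> d" using low_props(1)[of s' s] idx inv by auto
  then have "w = 0"
    using opposite_flags(2)[of r s "low W r r'" "d - low W s' s" w] idx less
      low_vector_flags[OF idx inv(2) w(2,3)] by auto
  with w show False by simp
qed

lemma low_vector_E:
  assumes idx: "{r, r', s, s'} \<subseteq> tetra_index" "distinct [r, r', s, s']"
    and inv: "\<And>w. w \<in> W \<Longrightarrow> X r r' w \<in> W" "\<And>w. w \<in> W \<Longrightarrow> X s s' w \<in> W"
  shows "\<exists>w i. w \<noteq> 0 \<and> w \<in> W \<and> w \<in> E r s (wt i)"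
proof -
  obtain w where w: "w \<noteq> 0" "w \<in> W" "w \<in> E r r' (wt (low W r r'))"
    using low_props(2)[of r r'] idx inv by auto
  have inv': "X r' r w \<in> W" "X s' s w \<in> W" if "w \<in> W" for w
    using skew[of r r' w] skew[of s s' w] inv[OF that] subspace_neg[OF W] idx by auto
  have "low W s' s \<le> low W r r'" using low_le[of r r' s s'] idx inv inv' by auto
  moreover have "low W r r' \<le> low W s' s" using low_le[of s' s r' r] idx inv inv' by auto
  ultimately have eq: "low W s' s = low W r r'" by simp
  have "low W r r' \<le> d" using low_props(1)[of r r'] idx inv by auto
  then have "w \<in> E r s (wt (low W r r'))"
    using opposite_flags(1)[of r s "low W r r'" "d - low W s' s" w] idx eq
      low_vector_flags[OF idx inv'(2) w(2,3)] by auto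
  with w show ?thesis by blast
qed

text \<open>The eigenvectors of \<open>X r s\<close> in \<open>W\<close> span a nonzero subspace;
  \<open>X r r'\<close> lowers and \<open>X s s'\<close> raises their eigenvalues, so minimality
  makes it all of \<open>W\<close>.\<close>

lemma minimal_invariant:
  assumes idx: "{r, r', s, s'} \<subseteq> tetra_index" "distinct [r, r', s, s']"
    and inv: "\<And>w. w \<in> W \<Longrightarrow> X r r' w \<in> W" "\<And>w. w \<in> W \<Longrightarrow> X s s' w \<in> W"
    and minimal: "\<And>U. subspace U \<Longrightarrow> U \<subseteq> W \<Longrightarrow> U \<noteq> {0} \<Longrightarrow>
      (\<And>u. u \<in> U \<Longrightarrow> X r r' u \<in> U) \<Longrightarrow> (\<And>u. u \<in> U \<Longrightarrow> X s s' u \<in> U) \<Longrightarrow> U = W"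
    and w: "w \<in> W"
  shows "X r s w \<in> W"
proof -
  let ?U = "span (\<Union>i. W \<inter> E r s (wt i))"
  have base: "e \<in> ?U" if "e \<in> W" "e \<in> E r s (wt i)" for e i
    using that by (auto intro: span_base)
  \<comment> \<open>Here \<open>f\<close> is the image of \<open>e\<close> under one of the two
    operators; the corrected vector \<open>f - scale c e\<close> stays in \<open>W\<close> and is an
    eigenvector of \<open>X r s\<close>.\<close>
  have shift: "f \<in> ?U" if e: "e \<in> W" "e \<in> E r s (wt i)" and "f \<in> W"
    and f: "f - scale c e \<in> E r s (wt j)" for e i j c f
  proof -
    have "f - scale c e \<in> W" using that W by (auto intro: subspace_diff subspace_scale)
    then have "f - scale c e + scale c e \<in> ?U"
      using f e by (intro span_add span_scale base)
    then show ?thesis by simp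
  qed
  have "?U = W"
  proof (rule minimal)
    show "?U \<subseteq> W" by (rule span_minimal[OF _ W]) auto
    show "?U \<noteq> {0}" using low_vector_E[OF idx inv] base by blast
    show "X r r' u \<in> ?U" if u: "u \<in> ?U" for u
    proof (rule linear_maps_span_into[OF lin subspace_span _ u], safe)
      fix e i assume e: "e \<in> W" "e \<in> E r s (wt i)"
      then have "X r r' e - scale (wt i) e \<in> E r s (wt i - 2)"
        using X_lowers_E[of r s r'] idx by auto
      then show "X r r' e \<in> ?U" using E_wt_pred[of r s i] idx shift e inv by auto
    qed
    show "X s s' u \<in> ?U" if u: "u \<in> ?U" for u
    proof (rule linear_maps_span_into[OF lin subspace_span _ u], safe)
      fix e i assume e: "e \<in> W" "e \<in> E r s (wt i)"
      then have "X s s' e - scale (- wt i) e \<in> E r s (wt (Suc i))"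
        using X_raises_E[of r s s'] idx by (auto simp: wt_Suc)
      then show "X s s' e \<in> ?U" using shift e inv by blast
    qed
  qed simp
  then have "w \<in> ?U" using w by simp
  then have "X r s w \<in> ?U"
  proof (rule linear_maps_span_into[OF lin subspace_span, rotated], safe)
    fix e i assume e: "e \<in> W" "e \<in> E r s (wt i)"
    then show "X r s e \<in> ?U" using span_scale[OF base[OF e]] by (simp add: mem_eigenspace_iff)
  qed
  with \<open>?U = W\<close> show ?thesis by simp
qed

end

text \<open>A minimal nonzero invariant subspace inside \<open>W\<close> is invariant under every
  generator, hence is the whole space.\<close>

lemma irreducible_X01_X23:
  assumes W: "subspace W" "\<And>w. w \<in> W \<Longrightarrow> X 0 1 w \<in> W" "\<And>w. w \<in> W \<Longrightarrow> X 2 3 w \<in> W"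
  shows "W = {0} \<or> W = UNIV"
proof (unfold disj_imp, rule impI)
  assume "W \<noteq> {0}"
  define P where "P U \<longleftrightarrow> subspace U \<and> U \<noteq> {0} \<and> (\<forall>u\<in>U. X 0 1 u \<in> U) \<and> (\<forall>u\<in>U. X 2 3 u \<in> U)" for U
  define Q where "Q U \<longleftrightarrow> P U \<and> U \<subseteq> W" for U
  have "Q W" using W \<open>W \<noteq> {0}\<close> by (simp add: P_def Q_def)
  \<comment> \<open>Least dimension yields minimality, since a subspace of \<open>U\<close> of no
    smaller dimension equals \<open>U\<close>.\<close>
  then obtain U where U: "Q U" "\<And>U'. Q U' \<Longrightarrow> dim U \<le> dim U'"
    using ex_has_least_nat[of Q W dim] by blast
  have sub: "subspace U" "U \<noteq> {0}" and inv: "\<And>u. u \<in> U \<Longrightarrow> X 0 1 u \<in> U" "\<And>u. u \<in> U \<Longrightarrow> X 2 3 u \<in> U"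
    using U(1) by (auto simp: P_def Q_def)
  have idx: "{0, 1, 2, 3} \<subseteq> tetra_index" by (simp add: tetra_index_def)
  have inv': "X 1 0 u \<in> U" "X 3 2 u \<in> U" if "u \<in> U" for u
    using skew[of 0 1 u] skew[of 2 3 u] idx inv[OF that] subspace_neg[OF sub(1)] by auto
  have neg: "X s r u \<in> U" if "{r, s} \<subseteq> tetra_index" "r \<noteq> s" "X r s u \<in> U" for r s u
    using skew[of r s u] that subspace_neg[OF sub(1)] by auto
  have minimal: "U' = U" if "subspace U'" "U' \<subseteq> U" "U' \<noteq> {0}"
    "\<And>u. u \<in> U' \<Longrightarrow> X 0 1 u \<in> U'" "\<And>u. u \<in> U' \<Longrightarrow> X 2 3 u \<in> U'" for U'
  proof -
    have "Q U'" using that U(1) by (auto simp: P_def Q_def)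
    from U(2)[OF this] show ?thesis using subspace_dim_equal that sub by blast
  qed
  \<comment> \<open>Swapping the indices of a generator only changes its sign, so minimality holds
    for all four choices of the two operators.\<close>
  have minimal': "U' = U" if U': "subspace U'" "U' \<subseteq> U" "U' \<noteq> {0}"
    and rs: "(r, s) \<in> {(0, 1), (1, 0)}" "(t, u) \<in> {(2, 3), (3, 2)}"
    and i: "\<And>u. u \<in> U' \<Longrightarrow> X r s u \<in> U'" "\<And>w. w \<in> U' \<Longrightarrow> X t u w \<in> U'" for U' r s t u
  proof (rule minimal[OF U'])
    fix w assume w: "w \<in> U'"
    show "X 0 1 w \<in> U'"
      using rs(1) i(1)[OF w] skew[of r s w] idx subspace_neg[OF U'(1)] by auto
    show "X 2 3 w \<in> U'"
      using rs(2) i(2)[OF w] skew[of t u w] idx subspace_neg[OF U'(1)] by auto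
  qed
  have cross: "X r t u \<in> U" if rs: "(r, s) \<in> {(0, 1), (1, 0)}" and tw: "(t, w) \<in> {(2, 3), (3, 2)}" and "u \<in> U" for r s t w :: nat and u
  proof (rule minimal_invariant[OF sub, of r s t w])
    show "{r, s, t, w} \<subseteq> tetra_index" using rs tw idx by auto
    show "distinct [r, s, t, w]" using rs tw by auto
    show "X r s u \<in> U" if "u \<in> U" for u
      using rs inv[OF that] inv'[OF that] by auto
    show "X t w u \<in> U" if "u \<in> U" for u
      using tw inv[OF that] inv'[OF that] by auto
    show "U' = U" if "subspace U'" "U' \<subseteq> U" "U' \<noteq> {0}"
      "\<And>u. u \<in> U' \<Longrightarrow> X r s u \<in> U'" "\<And>u. u \<in> U' \<Longrightarrow> X t w u \<in> U'" for U'
      by (rule minimal'[OF that(1-3) rs tw that(4,5)])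
  qed (fact that)
  have "X r s u \<in> U" if rs: "{r, s} \<subseteq> tetra_index" "r \<noteq> s" and u: "u \<in> U" for r s u
  proof -
    \<comment> \<open>One crossing generator for each choice of signs; the other four are their
      negatives.\<close>
    have "X 0 2 u \<in> U" "X 0 3 u \<in> U" "X 1 2 u \<in> U" "X 1 3 u \<in> U"
      using cross[of 0 1 2 3] cross[of 0 1 3 2] cross[of 1 0 2 3] cross[of 1 0 3 2] u
      by simp_all
    moreover from this have "X 2 0 u \<in> U" "X 3 0 u \<in> U" "X 2 1 u \<in> U" "X 3 1 u \<in> U"
      using neg idx by simp_all
    ultimately show ?thesis using inv[OF u] inv'[OF u] rs by (auto simp: tetra_index_def)
  qed
  then have "U = UNIV" using irreducible[OF sub(1)] sub(2) by blast
  then show "W = UNIV" using U(1) by (auto simp: Q_def)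
qed

lemma diagonalizable_X:
  assumes "{r, s} \<subseteq> tetra_index" "r \<noteq> s"
  shows "diagonalizable (X r s)"
proof (rule diagonalizableI)
  have "UNIV \<subseteq> span (\<Union>c. E r s c)"
    using span_mono[of "\<Union>i\<le>d. E r s (- of_nat d + 2 * of_nat i)" "\<Union>c. E r s c"]
      flag_full[OF assms] unfolding flag_def by blast
  then show "span (\<Union>c. E r s c) = UNIV" by blast
qed

text \<open>Reindexing by \<open>d - i\<close>; the summand \<open>0\<close> is the type scalar of
  \<open>onsager_has_type\<close>.\<close>

lemma spectrum_decreasing:
  assumes "{r, s} \<subseteq> tetra_index" "r \<noteq> s"
  shows "eigenvalues (X r s) = {of_nat d - 2 * of_nat i + 0 | i. i \<le> d}"
proof -
  have "\<exists>i\<le>d. of_nat d - 2 * of_nat j = (- of_nat d + 2 * of_nat i :: 'k)"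
    "\<exists>i\<le>d. - of_nat d + 2 * of_nat j = (of_nat d - 2 * of_nat i :: 'k)" if "j \<le> d" for j
    by (intro exI[of _ "d - j"] conjI; use that in \<open>simp add: of_nat_diff algebra_simps\<close>)+
  then show ?thesis unfolding spectrum[OF assms] by fastforce
qed

end

section \<open>Modules of Lie algebras given by generators and relations\<close>

text \<open>Induction on a representing expression; \<open>tetra_gen\<close> holds only pairs of
  distinct indices, which restricts the generator case.\<close>

lemma tetra_induct [case_names generator zero add scale bracket]:
  fixes x :: "'k::field tetra"
  assumes "\<And>r s. {r, s} \<subseteq> tetra_index \<Longrightarrow> r \<noteq> s \<Longrightarrow> P (tetra_X r s)" and "P 0"
    and "\<And>x y. P x \<Longrightarrow> P y \<Longrightarrow> P (x + y)" and "\<And>a x. P x \<Longrightarrow> P (tetra_scale a x)"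
    and "\<And>x y. P x \<Longrightarrow> P y \<Longrightarrow> P (tetra_bracket x y)"
  shows "P x"
proof (induction x rule: tetra.abs_induct)
  case (1 e)
  show ?case
  proof (induction e)
    case (LGen g)
    obtain r s where "g = Abs_tetra_gen (r, s)" "{r, s} \<subseteq> tetra_index" "r \<noteq> s"
      by (cases g rule: Abs_tetra_gen_cases) auto
    then show ?case using assms(1)[of r s] by (simp add: tetra_X.abs_eq tetra_X_def tetra_gen_expr_def)
  qed (use assms in \<open>simp_all add: zero_tetra.abs_eq[symmetric] plus_tetra.abs_eq[symmetric]
      tetra_scale.abs_eq[symmetric] tetra_bracket.abs_eq[symmetric] zero_tetra_def[symmetric]\<close>)
qed

lemma onsager_induct [case_names X Y zero add scale bracket]:
  fixes x :: "'k::field onsager"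
  assumes "P onsager_X" and "P onsager_Y" and "P 0"
    and "\<And>x y. P x \<Longrightarrow> P y \<Longrightarrow> P (x + y)" and "\<And>a x. P x \<Longrightarrow> P (onsager_scale a x)"
    and "\<And>x y. P x \<Longrightarrow> P y \<Longrightarrow> P (onsager_bracket x y)"
  shows "P x"
proof (induction x rule: onsager.abs_induct)
  case (1 e)
  show ?case
  proof (induction e)
    case (LGen g)
    show ?case using assms(1,2) by (cases g) (simp_all add: onsager_X_def onsager_Y_def)
  qed (use assms in \<open>simp_all add: zero_onsager_def[symmetric] plus_onsager.abs_eq[symmetric]
      onsager_scale.abs_eq[symmetric] onsager_bracket.abs_eq[symmetric]\<close>)
qed

context lie_module
begin

lemma act_zero_left: "act 0 v = 0"
  using act_scale_left[of 0 0 v] by simp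

lemma linear_act: "Vector_Spaces.linear scaleV scaleV (act x)"
  by (intro Vector_Spaces.linear.intro V.vector_space_axioms module_hom.intro V.module_axioms
      module_hom_axioms.intro act_add_right act_scale_right)

lemma act_bracket_commutator: "act (bracket x y) = commutator (act x) (act y)"
  by (rule ext) (simp add: act_bracket commutator_def)

end

section \<open>Onsager modules from pairs of operators\<close>

primrec lie_eval ::
  "('k \<Rightarrow> 'v \<Rightarrow> 'v) \<Rightarrow> ('x \<Rightarrow> 'v \<Rightarrow> 'v) \<Rightarrow> ('k, 'x) lie_expr \<Rightarrow> 'v \<Rightarrow> 'v::ab_group_add" where
  "lie_eval scale g (LGen x) = g x"
| "lie_eval scale g LZero = (\<lambda>v. 0)"
| "lie_eval scale g (LAdd s t) = (\<lambda>v. lie_eval scale g s v + lie_eval scale g t v)"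
| "lie_eval scale g (LScale a s) = (\<lambda>v. scale a (lie_eval scale g s v))"
| "lie_eval scale g (LBracket s t) = commutator (lie_eval scale g s) (lie_eval scale g t)"

context
  fixes scale :: "'k::field \<Rightarrow> 'v::ab_group_add \<Rightarrow> 'v" and g :: "'x \<Rightarrow> 'v \<Rightarrow> 'v"
  assumes vs: "vector_space scale" and g: "\<And>x. Vector_Spaces.linear scale scale (g x)"
begin

interpretation V: vector_space scale by (rule vs)

lemma lie_eval_add_scale:
  "lie_eval scale g e (v + w) = lie_eval scale g e v + lie_eval scale g e w \<and>
   lie_eval scale g e (scale a v) = scale a (lie_eval scale g e v)"
proof (induction e arbitrary: v w a)
  case (LGen x)
  interpret g: Vector_Spaces.linear scale scale "g x" by (rule g)
  show ?case by (simp add: g.add g.scale)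
qed (simp_all add: commutator_def V.scale_right_distrib V.scale_right_diff_distrib mult.commute)

text \<open>Commutators of linear operators satisfy the Lie axioms, so evaluation respects the
  congruence as soon as it respects \<open>R\<close>.\<close>

lemma lie_eval_cong:
  assumes "lie_cong R s t" and R: "\<And>s t. (s, t) \<in> R \<Longrightarrow> lie_eval scale g s = lie_eval scale g t"
  shows "lie_eval scale g s = lie_eval scale g t"
proof -
  have add: "lie_eval scale g e (v + w) = lie_eval scale g e v + lie_eval scale g e w"
    and scale: "lie_eval scale g e (scale a v) = scale a (lie_eval scale g e v)" for e v w a
    using lie_eval_add_scale by auto
  have zero: "lie_eval scale g e 0 = 0" for e using scale[of e 0 0] by simp
  have minus: "lie_eval scale g e (- v) = - lie_eval scale g e v" for e v
    using scale[of e "-1" v] by simp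
  have diff: "lie_eval scale g e (v - w) = lie_eval scale g e v - lie_eval scale g e w" for e v w
    using add[of e v "- w"] minus by simp
  show ?thesis
    using assms(1)
    by induction (auto intro!: ext simp: R commutator_def add scale diff zero V.scale_right_distrib
        V.scale_left_distrib V.scale_right_diff_distrib algebra_simps)
qed

end

lemma onsager_module_exists:
  assumes vs: "vector_space scale"
    and A: "Vector_Spaces.linear scale scale A" and B: "Vector_Spaces.linear scale scale B"
    and AB: "commutator A (commutator A (commutator A B)) = (\<lambda>v. scale 4 (commutator A B v))"
    and BA: "commutator B (commutator B (commutator B A)) = (\<lambda>v. scale 4 (commutator B A v))"
  shows "\<exists>act. lie_module onsager_scale onsager_bracket scale act \<and>
    act onsager_X = A \<and> act onsager_Y = B"
proof -
  interpret V: vector_space scale by fact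
  define g where "g x = (case x of Onsager_X \<Rightarrow> A | Onsager_Y \<Rightarrow> B)" for x
  have g: "Vector_Spaces.linear scale scale (g x)" for x
    using A B by (cases x) (simp_all add: g_def)
  let ?ev = "lie_eval scale g"
  \<comment> \<open>Defined through a chosen representative; \<open>abs\<close> shows that the
    choice does not matter.\<close>
  define act where "act x = ?ev (rep_onsager x)" for x
  have abs: "act (abs_onsager e) = ?ev e" for e
  proof -
    have "lie_cong onsager_relations (rep_onsager (abs_onsager e)) e"
      using onsager.abs_eq_iff Quotient_abs_rep[OF Quotient_onsager] by blast
    then show ?thesis unfolding act_def
      by (rule lie_eval_cong[OF vs g])
        (auto simp: onsager_relations_def Let_def g_def AB BA)
  qed
  interpret O: lie_algebra onsager_scale onsager_bracket by (rule lie_algebra_onsager)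
  have "lie_module onsager_scale onsager_bracket scale act"
  proof
    fix a x y v w
    show "act x (v + w) = act x v + act x w" "act x (scale a v) = scale a (act x v)"
      unfolding act_def using lie_eval_add_scale[OF vs, of g, OF g] by auto
    show "act (x + y) v = act x v + act y v"
      by (induction x rule: onsager.abs_induct, induction y rule: onsager.abs_induct)
        (simp add: plus_onsager.abs_eq abs)
    show "act (onsager_scale a x) v = scale a (act x v)"
      by (induction x rule: onsager.abs_induct) (simp add: onsager_scale.abs_eq abs)
    show "act (onsager_bracket x y) v = act x (act y v) - act y (act x v)"
      by (induction x rule: onsager.abs_induct, induction y rule: onsager.abs_induct)
        (simp add: onsager_bracket.abs_eq abs commutator_def)
  qed
  moreover have "act onsager_X = A" "act onsager_Y = B"
    by (simp_all add: onsager_X_def onsager_Y_def abs g_def)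
  ultimately show ?thesis by blast
qed

lemma onsager_module_unique:
  assumes "lie_module onsager_scale onsager_bracket scale act"
    and "lie_module onsager_scale onsager_bracket scale act'"
    and "act onsager_X = act' onsager_X" "act onsager_Y = act' onsager_Y"
  shows "act = act'"
proof
  interpret A: lie_module onsager_scale onsager_bracket scale act by fact
  interpret B: lie_module onsager_scale onsager_bracket scale act' by fact
  fix x show "act x = act' x"
    by (induction x rule: onsager_induct)
      (use assms(3,4) in \<open>auto simp: fun_eq_iff A.act_zero_left B.act_zero_left A.act_add_left
        B.act_add_left A.act_scale_left B.act_scale_left A.act_bracket B.act_bracket\<close>)
qed

section \<open>From tetrahedron modules to operators and back to Onsager modules\<close>

lemma tetra_module_irreducible_ops:
  fixes scale :: "'k::{alg_closed_field, field_char_0} \<Rightarrow> 'v::ab_group_add \<Rightarrow> 'v"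
  assumes "irreducible_lie_module tetra_scale tetra_bracket scale act"
    and "finite_dimensional_vector_space scale Basis"
  shows "irreducible_tetra_ops scale Basis (\<lambda>r s. act (tetra_X r s))"
proof -
  interpret irreducible_lie_module tetra_scale tetra_bracket scale act by fact
  interpret finite_dimensional_vector_space scale Basis by fact
  show ?thesis
  proof
    fix r s t u :: nat and v w :: 'v and a :: 'k
    show "act (tetra_X r s) (v + w) = act (tetra_X r s) v + act (tetra_X r s) w"
      by (rule act_add_right)
    show "act (tetra_X r s) (scale a v) = scale a (act (tetra_X r s) v)" by (rule act_scale_right)
    show "act (tetra_X s r) v = - act (tetra_X r s) v"
      if "{r, s} \<subseteq> tetra_index" "distinct [r, s]"
      using act_add_left[of "tetra_X r s" "tetra_X s r" v] tetra_X_skew[OF that, where 'k = 'k]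
      by (simp add: act_zero_left eq_neg_iff_add_eq_0 add.commute)
    show "commutator (act (tetra_X r s)) (act (tetra_X s t)) v =
        scale 2 (act (tetra_X r s) v) + scale 2 (act (tetra_X s t) v)"
      if "{r, s, t} \<subseteq> tetra_index" "distinct [r, s, t]"
      by (simp add: act_bracket_commutator[symmetric] tetra_X_bracket[OF that]
          act_add_left act_scale_left)
    show "commutator (act (tetra_X r s)) (commutator (act (tetra_X r s))
          (commutator (act (tetra_X r s)) (act (tetra_X t u)))) v =
        scale 4 (commutator (act (tetra_X r s)) (act (tetra_X t u)) v)"
      if "{r, s, t, u} \<subseteq> tetra_index" "distinct [r, s, t, u]"
      by (simp add: act_bracket_commutator[symmetric] tetra_X_Dolan_Grady[OF that] act_scale_left)
  next
    show "\<exists>v::'v. v \<noteq> 0" by (rule nonzero)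
  next
    fix W :: "'v set"
    assume W: "V.subspace W"
      and inv: "\<And>r s w. {r, s} \<subseteq> tetra_index \<Longrightarrow> r \<noteq> s \<Longrightarrow> w \<in> W \<Longrightarrow> act (tetra_X r s) w \<in> W"
    \<comment> \<open>Invariance under the generators passes to the whole algebra, so
      \<open>W\<close> is a submodule.\<close>
    have "\<forall>w\<in>W. act x w \<in> W" for x
    proof (induction x rule: tetra_induct)
      case (bracket x y)
      then show ?case using V.subspace_diff[OF W] by (simp add: act_bracket)
    qed (use inv V.subspace_0[OF W] V.subspace_add[OF W] V.subspace_scale[OF W] in
        \<open>auto simp: act_zero_left act_add_left act_scale_left\<close>)
    then show "W = {0} \<or> W = UNIV" using irreducible W by (simp add: submodule_def)
  qed
qed

theorem theorem1p7:
  fixes scale :: "'k::{alg_closed_field, field_char_0} \<Rightarrow> 'v::ab_group_add \<Rightarrow> 'v"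
    and act :: "'k tetra \<Rightarrow> 'v \<Rightarrow> 'v"
  assumes "irreducible_lie_module tetra_scale tetra_bracket scale act"
    and "vector_space.finite_dimensional scale"
  shows "(\<exists>!act' :: 'k onsager \<Rightarrow> 'v \<Rightarrow> 'v.
            lie_module onsager_scale onsager_bracket scale act' \<and>
            act' onsager_X = act (tetra_X 0 1) \<and>
            act' onsager_Y = act (tetra_X 2 3)) \<and>
         (\<forall>act' :: 'k onsager \<Rightarrow> 'v \<Rightarrow> 'v.
            lie_module onsager_scale onsager_bracket scale act' \<and>
            act' onsager_X = act (tetra_X 0 1) \<and>
            act' onsager_Y = act (tetra_X 2 3) \<longrightarrow>
            irreducible_lie_module onsager_scale onsager_bracket scale act' \<and>
            onsager_has_type scale act' (0, 0))"
proof (intro conjI allI impI; (elim conjE)?)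
  interpret irreducible_lie_module tetra_scale tetra_bracket scale act by fact
  obtain B where B: "finite_dimensional_vector_space scale B"
    using assms(2) V.finite_dimensional_def by blast
  interpret ops: irreducible_tetra_ops scale B "\<lambda>r s. act (tetra_X r s)"
    by (rule tetra_module_irreducible_ops[OF assms(1) B])
  obtain d where d: "\<And>r s. {r, s} \<subseteq> tetra_index \<Longrightarrow> r \<noteq> s \<Longrightarrow>
      V.eigenvalues (act (tetra_X r s)) = {- of_nat d + 2 * of_nat i | i. i \<le> d} \<and>
      ops.flag r s (- of_nat d) d = UNIV"
    by (rule ops.common_eigenvalues) (rule that, blast)
  interpret ops: irreducible_tetra_ops_diameter scale B "\<lambda>r s. act (tetra_X r s)" d
    by unfold_locales (use d in blast)+
  have idx: "{0, 1, 2, 3} \<subseteq> tetra_index" "{2, 3, 0, 1} \<subseteq> tetra_index"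
    "{0, 1} \<subseteq> tetra_index" "{2, 3} \<subseteq> tetra_index"
    by (auto simp: tetra_index_def)
  show "\<exists>!act'. lie_module onsager_scale onsager_bracket scale act' \<and>
            act' onsager_X = act (tetra_X 0 1) \<and> act' onsager_Y = act (tetra_X 2 3)"
  proof (rule ex_ex1I)
    \<comment> \<open>The two Onsager relations are the tetrahedron Dolan-Grady relations for the
      index sequences \<open>0, 1, 2, 3\<close> and \<open>2, 3, 0, 1\<close>.\<close>
    show "\<exists>act'. lie_module onsager_scale onsager_bracket scale act' \<and>
            act' onsager_X = act (tetra_X 0 1) \<and> act' onsager_Y = act (tetra_X 2 3)"
      by (rule onsager_module_exists[OF V.vector_space_axioms linear_act linear_act])
        (rule ext, rule ops.Dolan_Grady, use idx in auto)+
  qed (metis onsager_module_unique)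
  fix act' :: "'k onsager \<Rightarrow> 'v \<Rightarrow> 'v"
  assume mod: "lie_module onsager_scale onsager_bracket scale act'"
    and XY: "act' onsager_X = act (tetra_X 0 1)" "act' onsager_Y = act (tetra_X 2 3)"
  interpret O: lie_module onsager_scale onsager_bracket scale act' by (rule mod)
  show "irreducible_lie_module onsager_scale onsager_bracket scale act'"
  proof
    show "\<exists>v::'v. v \<noteq> 0" by (rule nonzero)
    show "W = {0} \<or> W = UNIV" if "O.submodule W" for W
    proof (rule ops.irreducible_X01_X23)
      show "V.subspace W" using that by (simp add: O.submodule_def)
      show "act (tetra_X 0 1) w \<in> W" if "w \<in> W" for w
        using that \<open>O.submodule W\<close> unfolding XY[symmetric] O.submodule_def by blast
      show "act (tetra_X 2 3) w \<in> W" if "w \<in> W" for w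
        using that \<open>O.submodule W\<close> unfolding XY[symmetric] O.submodule_def by blast
    qed
  qed
  show "onsager_has_type scale act' (0, 0)"
    unfolding onsager_has_type_def case_prod_conv XY
    using ops.diagonalizable_X ops.spectrum_decreasing idx by (intro conjI exI[of _ d]) auto
qed

end
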